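(* Let $G$ be a connected graph of order $n$ with diameter $d\ge 2$, and suppose $G$ is not isomorphic to the path $P_{d+1}$. Then $m_G[n-d+2,n]\le n-d$, with equality if and only if (i) $G\cong G_{n,d,t}$ for some integer $t$ with $2\le t\le \lfloor d/2\rfloor+1$, or (ii) $G\cong G_{n,d,r,a}$ for some integers $r,a$ with $2\le r\le \lfloor (d+1)/2\rfloor$ and $1\le a\le n-d-2$.
   Context: All graphs are finite and simple. The Laplacian matrix of a graph $G$ is $L(G)=D(G)-A(G)$ (degree diagonal matrix minus adjacency matrix); its eigenvalues, the Laplacian eigenvalues, are denoted $\mu_1(G)\ge\mu_2(G)\ge\dots\ge\mu_n(G)$ and all lie in $[0,n]$. For an interval $I\subseteq[0,n]$, $m_G I$ denotes the number of Laplacian eigenvalues of $G$ (counted with multiplicity) lying in $I$. The diameter is the largest distance between two vertices. $P_k$ is the path on $k$ vertices and $K_k$ the complete graph on $k$ vertices. For integers $2\le d\le n-2$ and $2\le t\le d$, $G_{n,d,t}$ is the graph obtained from a path $v_1v_2\dots v_{d+1}$ and a vertex-disjoint complete graph $K_{n-d-1}$ by adding all edges between every vertex of $K_{n-d-1}$ and each of $v_{t-1},v_t,v_{t+1}$. For integers $3\le d\le n-2$, $2\le r\le d-1$ and $1\le a\le n-d-2$, $G_{n,d,r,a}$ is the graph obtained from a path $v_1v_2\dots v_{d+1}$ and a vertex-disjoint complete graph $K_{n-d-1}$ by adding all edges between every vertex of $K_{n-d-1}$ and each of $v_r,v_{r+1}$, all edges between $v_{r-1}$ and a fixed set of $a$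 vertices of $K_{n-d-1}$, and all edges between $v_{r+2}$ and each of the remaining $n-d-1-a$ vertices of $K_{n-d-1}$. *)

theory Defs
  imports "Jordan_Normal_Form.Char_Poly"
begin

definition simple_graph :: "nat \<Rightarrow> (nat \<Rightarrow> nat \<Rightarrow> bool) \<Rightarrow> bool" where
  "simple_graph n E \<longleftrightarrow> (\<forall>i j. E i j \<longrightarrow> i < n \<and> j < n) \<and> (\<forall>i j. E i j \<longleftrightarrow> E j i) \<and> (\<forall>i. \<not> E i i)"

definition degree :: "nat \<Rightarrow> (nat \<Rightarrow> nat \<Rightarrow> bool) \<Rightarrow> nat \<Rightarrow> nat" where
  "degree n E i = card {k. k < n \<and> E i k}"

definition laplacian :: "nat \<Rightarrow> (nat \<Rightarrow> nat \<Rightarrow> bool) \<Rightarrow> real mat" where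
  "laplacian n E = mat n n (\<lambda>(i, j). (if i = j then real (degree n E i) else 0) - (if E i j then 1 else 0))"

definition lap_count :: "nat \<Rightarrow> (nat \<Rightarrow> nat \<Rightarrow> bool) \<Rightarrow> real set \<Rightarrow> nat" where
  "lap_count n E I = (\<Sum>x \<in> {x \<in> I. poly (char_poly (laplacian n E)) x = 0}. order x (char_poly (laplacian n E)))"

inductive walk_len :: "(nat \<Rightarrow> nat \<Rightarrow> bool) \<Rightarrow> nat \<Rightarrow> nat \<Rightarrow> nat \<Rightarrow> bool" for E where
  walk_nil: "walk_len E 0 i i"
| walk_cons: "E i j \<Longrightarrow> walk_len E k j l \<Longrightarrow> walk_len E (Suc k) i l"

definition connected_graph :: "nat \<Rightarrow> (nat \<Rightarrow> nat \<Rightarrow> bool) \<Rightarrow> bool" where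
  "connected_graph n E \<longleftrightarrow> (\<forall>i < n. \<forall>j < n. \<exists>k. walk_len E k i j)"

definition graph_dist :: "(nat \<Rightarrow> nat \<Rightarrow> bool) \<Rightarrow> nat \<Rightarrow> nat \<Rightarrow> nat" where
  "graph_dist E i j = (LEAST k. walk_len E k i j)"

definition diameter :: "nat \<Rightarrow> (nat \<Rightarrow> nat \<Rightarrow> bool) \<Rightarrow> nat" where
  "diameter n E = Max {graph_dist E i j | i j. i < n \<and> j < n}"

definition graph_iso :: "nat \<Rightarrow> (nat \<Rightarrow> nat \<Rightarrow> bool) \<Rightarrow> nat \<Rightarrow> (nat \<Rightarrow> nat \<Rightarrow> bool) \<Rightarrow> bool" where
  "graph_iso n E m F \<longleftrightarrow> (\<exists>f. bij_betw f {0..<n} {0..<m} \<and> (\<forall>i < n. \<forall>j < n. E i j \<longleftrightarrow> F (f i) (f j)))"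

definition path_graph :: "nat \<Rightarrow> nat \<Rightarrow> nat \<Rightarrow> bool" where
  "path_graph m i j \<longleftrightarrow> i < m \<and> j < m \<and> (i + 1 = j \<or> j + 1 = i)"

text \<open>In G_{n,d,t} and G_{n,d,r,a}, path vertex v_k is the index k-1 (0..d),
  and the clique K_{n-d-1} consists of the indices d+1..n-1.\<close>
definition G_ndt :: "nat \<Rightarrow> nat \<Rightarrow> nat \<Rightarrow> nat \<Rightarrow> nat \<Rightarrow> bool" where
  "G_ndt n d t i j \<longleftrightarrow> i < n \<and> j < n \<and> i \<noteq> j \<and>
     ((i \<le> d \<and> j \<le> d \<and> (i + 1 = j \<or> j + 1 = i))
      \<or> (d < i \<and> d < j)
      \<or> (d < i \<and> j \<in> {t - 2, t - 1, t})
      \<or> (d < j \<and> i \<in> {t - 2, t - 1, t}))"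

text \<open>clique vertex c (d < c) adjacent to v_r, v_{r+1} (indices r-1, r);
  v_{r-1} (index r-2) adjacent to the a clique vertices d+1..d+a;
  v_{r+2} (index r+1) adjacent to the remaining clique vertices.\<close>
definition cross_ndra :: "nat \<Rightarrow> nat \<Rightarrow> nat \<Rightarrow> nat \<Rightarrow> nat \<Rightarrow> bool" where
  "cross_ndra d r a c v \<longleftrightarrow> v = r - 1 \<or> v = r \<or> (v = r - 2 \<and> c \<le> d + a) \<or> (v = r + 1 \<and> d + a < c)"

definition G_ndra :: "nat \<Rightarrow> nat \<Rightarrow> nat \<Rightarrow> nat \<Rightarrow> nat \<Rightarrow> nat \<Rightarrow> bool" where
  "G_ndra n d r a i j \<longleftrightarrow> i < n \<and> j < n \<and> i \<noteq> j \<and>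
     ((i \<le> d \<and> j \<le> d \<and> (i + 1 = j \<or> j + 1 = i))
      \<or> (d < i \<and> d < j)
      \<or> (d < i \<and> j \<le> d \<and> cross_ndra d r a i j)
      \<or> (d < j \<and> i \<le> d \<and> cross_ndra d r a j i))"

end

theory Submission
  imports Defs "Jordan_Normal_Form.Spectral_Radius"
begin

text \<open>
  Number a diametral path \<open>0, \<dots>, d\<close>. A vertex \<open>w\<close> off the path has its path neighbours inside some triple
  \<open>{t - 1, t, t + 1}\<close>. For vectors \<open>x\<close> supported on the path and \<open>w\<close> with \<open>x w = - x t\<close>, the gap
  \<open>(n - d + 2) |x|\<^sup>2 - x\<^sup>T L x\<close> is a sum of squares. These are \<open>n - d - 1\<close> linear constraints,
  and with the additional one \<open>x w = 0\<close> the gap is positive definite, so at most \<open>n - d\<close>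
  eigenvalues are \<open>\<ge> n - d + 2\<close>. If there are exactly \<open>n - d\<close>, then the gap vanishes at a nonzero
  vector, necessarily a multiple of \<open>e\<^sub>w - e\<^sub>t\<close>; this forces \<open>w\<close> to be adjacent to its whole
  triple and every other vertex off the path to be adjacent to both \<open>w\<close> and \<open>t\<close>.
  Hence the vertices off the path form a clique whose triples have centres \<open>s\<close> or \<open>s + 1\<close>, which are the two families up to reversal of the
  path. Conversely, each member of the families has an \<open>(n - d)\<close>-dimensional space of vectors on
  which the Laplacian form is at least \<open>(n - d + 2) |x|\<^sup>2\<close>.
\<close>

section \<open>Orthogonal diagonalization of real symmetric matrices\<close>

text \<open>The reflection along \<open>u\<close>, the difference of the first unit vector and
  \<open>v\<close>, exchanges these two vectors. It is symmetric and its own inverse, so conjugation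
  by it is an orthogonal change of basis that puts \<open>v\<close> first.\<close>

lemma householder_reflection:
  fixes v :: "real vec"
  assumes v: "v \<in> carrier_vec n" and vv: "v \<bullet> v = 1" and n: "0 < n"
  obtains H where "H \<in> carrier_mat n n" "H\<^sup>T = H" "H * H = 1\<^sub>m n" "col H 0 = v"
proof -
  define u where "u = unit_vec n 0 - v"
  define s where "s = 2 / (u \<bullet> u)"
  define H where "H = mat n n (\<lambda>(i, j). (if i = j then 1 else 0) - s * u $ i * u $ j)"
  have u: "u \<in> carrier_vec n" using v by (simp add: u_def)
  have ui: "u $ i = (if i = 0 then 1 else 0) - v $ i" if "i < n" for i
    using that v n by (simp add: u_def unit_vec_def)
  have uu: "u \<bullet> u = 2 - 2 * v $ 0"
  proof -
    have "u \<bullet> u = unit_vec n 0 \<bullet> unit_vec n 0 - 2 * (unit_vec n 0 \<bullet> v) + v \<bullet> v"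
      unfolding u_def using v n
      by (simp add: minus_scalar_prod_distrib[of _ n] scalar_prod_minus_distrib[of _ n]
          comm_scalar_prod[of v n "unit_vec n 0"])
    then show ?thesis using vv v n by simp
  qed
  \<comment> \<open>This covers \<open>u = 0\<close> as well: division by zero then makes
    \<open>s = 0\<close>, and \<open>H\<close> is the identity.\<close>
  have s2: "s * s * (u \<bullet> u) = 2 * s"
    by (simp add: s_def)
  have H: "H \<in> carrier_mat n n" by (simp add: H_def)
  have "H\<^sup>T = H" by (rule eq_matI) (auto simp: H_def)
  moreover have "H * H = 1\<^sub>m n"
  proof (rule eq_matI)
    fix i j assume "i < dim_row (1\<^sub>m n :: real mat)" "j < dim_col (1\<^sub>m n :: real mat)"
    then have ij: "i < n" "j < n" by auto
    have "(H * H) $$ (i, j) = (\<Sum>k = 0..<n. ((if i = k then 1 else 0) - s * u $ i * u $ k)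
        * ((if k = j then 1 else 0) - s * u $ k * u $ j))"
      using ij by (simp add: H_def scalar_prod_def)
    also have "\<dots> = (\<Sum>k = 0..<n. (if i = k then (if k = j then 1 else 0) - s * u $ k * u $ j else 0)
        - (if k = j then s * u $ i * u $ k else 0) + s * s * u $ i * u $ j * (u $ k * u $ k))"
      by (intro sum.cong) (auto simp: algebra_simps)
    also have "\<dots> = (if i = j then 1 else 0) - 2 * s * u $ i * u $ j + s * s * u $ i * u $ j * (u \<bullet> u)"
      using ij u by (simp add: sum.distrib sum_subtractf scalar_prod_def sum_distrib_left)
    also have "s * s * u $ i * u $ j * (u \<bullet> u) = 2 * s * u $ i * u $ j"
      using s2 by (metis mult.assoc mult.commute)
    finally show "(H * H) $$ (i, j) = 1\<^sub>m n $$ (i, j)" using ij by simp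
  qed (auto simp: H_def)
  moreover have "col H 0 = v"
  proof (rule eq_vecI)
    fix i assume "i < dim_vec v"
    then have i: "i < n" using v by simp
    have "col H 0 $ i = (if i = 0 then 1 else 0) - (s * u $ 0) * u $ i"
      using i n by (simp add: H_def)
    also have "(s * u $ 0) * u $ i = u $ i"
    proof (cases "u \<bullet> u = 0")
      case True
      then have "u = 0\<^sub>v n"
        using conjugate_square_eq_0_vec[OF u] by simp
      then show ?thesis using i by simp
    next
      case False
      then show ?thesis using n uu by (simp add: s_def ui)
    qed
    finally show "col H 0 $ i = v $ i" using ui[OF i] by simp
  qed (use v in \<open>simp add: H_def\<close>)
  ultimately show thesis using that H by blast
qed

text \<open>Over the complex numbers the spectrum is nonempty. Pairing an eigenvector with its
  conjugate shows that the eigenvalue is real; it is then a root of the real characteristic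
  polynomial and so has a real eigenvector.\<close>

lemma symmetric_real_eigenvector:
  fixes A :: "real mat"
  assumes A: "A \<in> carrier_mat n n" and sym: "A\<^sup>T = A" and n: "0 < n"
  obtains e v where "v \<in> carrier_vec n" "v \<bullet> v = 1" "A *\<^sub>v v = e \<cdot>\<^sub>v v"
proof -
  define B where "B = map_mat complex_of_real A"
  have B: "B \<in> carrier_mat n n" using A by (simp add: B_def)
  obtain z where "z \<in> spectrum B" using spectrum_non_empty[OF B n] by auto
  then have ev: "eigenvalue B z" by (simp add: spectrum_def)
  then obtain x where "eigenvector B x z" by (auto simp: eigenvalue_def)
  then have x: "x \<in> carrier_vec n" "x \<noteq> 0\<^sub>v n" and Bx: "B *\<^sub>v x = z \<cdot>\<^sub>v x"
    using B by (auto simp: eigenvector_def)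
  have cBx: "B *\<^sub>v conjugate x = conjugate z \<cdot>\<^sub>v conjugate x"
  proof -
    have "B *\<^sub>v conjugate x = conjugate (B *\<^sub>v x)"
    proof (rule eq_vecI)
      fix i assume "i < dim_vec (conjugate (B *\<^sub>v x))"
      then have i: "i < n" using B by simp
      then show "(B *\<^sub>v conjugate x) $ i = conjugate (B *\<^sub>v x) $ i"
        using A x by (auto simp: B_def scalar_prod_def sum_conjugate conjugate_dist_mul intro!: sum.cong)
    qed (use B in auto)
    also have "\<dots> = conjugate z \<cdot>\<^sub>v conjugate x"
      unfolding Bx by (rule conjugate_smult_vec)
    finally show ?thesis .
  qed
  have "B\<^sup>T = B" unfolding B_def using sym by (metis map_mat_transpose)
  then have "(B *\<^sub>v x) \<bullet> conjugate x = x \<bullet> (B *\<^sub>v conjugate x)"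
    using transpose_vec_mult_scalar[OF B, of "conjugate x" x] x B
    by (metis carrier_vec_conjugate comm_scalar_prod mult_mat_vec_carrier)
  then have "z * (x \<bullet> conjugate x) = conjugate z * (x \<bullet> conjugate x)"
    unfolding Bx cBx using x by simp
  moreover have "x \<bullet> conjugate x \<noteq> 0" using x by (simp add: conjugate_square_eq_0_vec)
  ultimately have "z = cnj z" by (simp add: conjugate_complex_def)
  then have zr: "z = complex_of_real (Re z)" by (metis Reals_cnj_iff complex_is_Real_iff of_real_Re)
  have "poly (char_poly B) z = 0" using eigenvalue_root_char_poly[OF B] ev by simp
  then have "complex_of_real (poly (char_poly A) (Re z)) = 0"
    unfolding B_def of_real_hom.char_poly_hom[OF A] using zr
    by (metis of_real_hom.poly_map_poly)
  then have "eigenvalue A (Re z)" using eigenvalue_root_char_poly[OF A] by simp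
  then obtain y where "eigenvector A y (Re z)" by (auto simp: eigenvalue_def)
  then have y: "y \<in> carrier_vec n" "y \<noteq> 0\<^sub>v n" and Ay: "A *\<^sub>v y = Re z \<cdot>\<^sub>v y"
    using A by (auto simp: eigenvector_def)
  have pos: "y \<bullet> y > 0" using y conjugate_square_greater_0_vec[OF y(1)] by simp
  define c where "c = 1 / sqrt (y \<bullet> y)"
  show thesis
  proof (rule that)
    show "c \<cdot>\<^sub>v y \<in> carrier_vec n" using y by simp
    show "(c \<cdot>\<^sub>v y) \<bullet> (c \<cdot>\<^sub>v y) = 1" using y pos by (simp add: c_def field_simps)
    show "A *\<^sub>v (c \<cdot>\<^sub>v y) = Re z \<cdot>\<^sub>v (c \<cdot>\<^sub>v y)"
      using y A Ay by (simp add: mult_mat_vec smult_smult_assoc mult.commute)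
  qed
qed

text \<open>Deflation: after conjugation by a reflection whose first column is a unit eigenvector,
  the first column is diagonal, symmetry gives the same for the first row, and the induction
  hypothesis applies to the remaining symmetric block.\<close>

lemma symmetric_real_diagonalization:
  fixes A :: "real mat"
  assumes "A \<in> carrier_mat n n" and "A\<^sup>T = A"
  shows "\<exists>B P. similar_mat_wit A B P P\<^sup>T \<and> diagonal_mat B"
  using assms
proof (induction n arbitrary: A)
  case 0
  then have "similar_mat_wit A A (1\<^sub>m 0) (1\<^sub>m 0)\<^sup>T" by (auto simp: similar_mat_wit_def Let_def)
  moreover have "diagonal_mat A" using 0 by (auto simp: diagonal_mat_def)
  ultimately show ?case by blast
next
  case (Suc n)
  note A = Suc.prems(1)
  obtain e v where v: "v \<in> carrier_vec (Suc n)" "v \<bullet> v = 1" and Av: "A *\<^sub>v v = e \<cdot>\<^sub>v v"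
    using symmetric_real_eigenvector[OF Suc.prems] by blast
  obtain H where H: "H \<in> carrier_mat (Suc n) (Suc n)" "H\<^sup>T = H" "H * H = 1\<^sub>m (Suc n)" "col H 0 = v"
    using householder_reflection[OF v] by blast
  define C where "C = H * A * H"
  have C: "C \<in> carrier_mat (Suc n) (Suc n)" using H A by (simp add: C_def)
  have AC: "similar_mat_wit A C H H"
  proof (rule similar_mat_witI[OF H(3) H(3) _ A C H(1) H(1)])
    have "H * C * H = (H * H) * A * (H * H)"
      unfolding C_def using H(1) A by (simp add: assoc_mult_mat[of _ "Suc n" "Suc n" _ "Suc n" _ "Suc n"])
    then show "A = H * C * H" using H A by simp
  qed
  have symC: "C\<^sup>T = C"
    unfolding C_def using H A Suc.prems(2)
    by (simp add: transpose_mult[of _ "Suc n" "Suc n" _ "Suc n"]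
        assoc_mult_mat[of _ "Suc n" "Suc n" _ "Suc n" _ "Suc n"])
  have "col C 0 = (H * A) *\<^sub>v col H 0"
    unfolding C_def by (rule col_mult2[of _ "Suc n" "Suc n" _ "Suc n"]) (use H A in auto)
  also have "\<dots> = H *\<^sub>v (A *\<^sub>v v)"
    unfolding H(4) by (rule assoc_mult_mat_vec[OF H(1) A v(1)])
  also have "\<dots> = e \<cdot>\<^sub>v (H *\<^sub>v col H 0)"
    unfolding Av using H v by (simp add: mult_mat_vec)
  also have "H *\<^sub>v col H 0 = unit_vec (Suc n) 0"
    using col_mult2[OF H(1) H(1), of 0] H(3) by simp
  finally have col0: "C $$ (i, 0) = (if i = 0 then e else 0)" if "i < Suc n" for i
    using that C by (auto dest!: arg_cong[of _ _ "\<lambda>v. v $ i"])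
  have row0: "C $$ (0, i) = (if i = 0 then e else 0)" if "i < Suc n" for i
    using col0[OF that] symC C that by (metis carrier_matD index_transpose_mat(1) zero_less_Suc)
  define D where "D = mat n n (\<lambda>(i, j). C $$ (Suc i, Suc j))"
  define M where "M = mat 1 1 (\<lambda>_. e)"
  have D: "D \<in> carrier_mat n n" by (simp add: D_def)
  have M: "M \<in> carrier_mat 1 1" by (simp add: M_def)
  have block: "C = four_block_mat M (0\<^sub>m 1 n) (0\<^sub>m n 1) D"
  proof (rule eq_matI)
    fix i j assume "i < dim_row (four_block_mat M (0\<^sub>m 1 n) (0\<^sub>m n 1) D)"
      "j < dim_col (four_block_mat M (0\<^sub>m 1 n) (0\<^sub>m n 1) D)"
    then have "i < Suc n" "j < Suc n" by (auto simp: M_def D_def)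
    then show "C $$ (i, j) = four_block_mat M (0\<^sub>m 1 n) (0\<^sub>m n 1) D $$ (i, j)"
      using row0[of j] col0[of i] by (auto simp: M_def D_def)
  qed (use C in \<open>auto simp: M_def D_def\<close>)
  have "D\<^sup>T = D"
  proof (rule eq_matI)
    fix i j assume "i < dim_row D" "j < dim_col D"
    then have ij: "i < n" "j < n" by (auto simp: D_def)
    have "C $$ (Suc j, Suc i) = C\<^sup>T $$ (Suc i, Suc j)" using ij C by simp
    then show "D\<^sup>T $$ (i, j) = D $$ (i, j)" using ij by (simp add: D_def symC)
  qed (auto simp: D_def)
  then obtain D' P where DP: "similar_mat_wit D D' P P\<^sup>T" "diagonal_mat D'"
    using Suc.IH[OF D] by blast
  have c: "D' \<in> carrier_mat n n" "P \<in> carrier_mat n n"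
    using similar_mat_witD2[OF D DP(1)] by auto
  let ?B = "four_block_mat M (0\<^sub>m 1 n) (0\<^sub>m n 1) D'"
  let ?R = "four_block_mat (1\<^sub>m 1) (0\<^sub>m 1 n) (0\<^sub>m n 1) P"
  let ?S = "four_block_mat (1\<^sub>m 1) (0\<^sub>m 1 n) (0\<^sub>m n 1) (P\<^sup>T)"
  have "similar_mat_wit M M (1\<^sub>m 1) (1\<^sub>m 1)" by (rule similar_mat_wit_refl[OF M])
  from similar_mat_wit_four_block[OF this DP(1) _ _ M D zero_carrier_mat zero_carrier_mat]
  have "similar_mat_wit C ?B ?R ?S"
    unfolding block using c M by simp
  from similar_mat_wit_trans[OF AC this] have "similar_mat_wit A ?B (H * ?R) (?S * H)" .
  moreover have "?R\<^sup>T = ?S"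
    using c by (subst transpose_four_block_mat[where ?nr1.0=1 and ?nc1.0=1 and ?nr2.0=n and ?nc2.0=n]) auto
  then have "(H * ?R)\<^sup>T = ?S * H"
    using H c by (subst transpose_mult[where nr="Suc n" and n="Suc n" and nc="Suc n"]) auto
  moreover have "diagonal_mat ?B"
    using DP(2) c M by (auto simp: diagonal_mat_def)
  ultimately show ?case by metis
qed

section \<open>Counting Laplacian eigenvalues by constrained test vectors\<close>

text \<open>The eigenvectors \<open>u k\<close> are the columns of the orthogonal matrix. Indexing
  the linear factors of the characteristic polynomial by \<open>k\<close> lets multiplicities be
  handled by counting indices.\<close>

lemma symmetric_real_orthonormal_eigenbasis:
  fixes A :: "real mat"
  assumes A: "A \<in> carrier_mat n n" and sym: "A\<^sup>T = A"
  obtains \<mu> :: "nat \<Rightarrow> real" and u :: "nat \<Rightarrow> nat \<Rightarrow> real" where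
    "\<And>k l. k < n \<Longrightarrow> l < n \<Longrightarrow> (\<Sum>i<n. u k i * u l i) = (if k = l then 1 else 0)"
    "\<And>k i. k < n \<Longrightarrow> i < n \<Longrightarrow> (\<Sum>j<n. A $$ (i, j) * u k j) = \<mu> k * u k i"
    "char_poly A = (\<Prod>k<n. [:- \<mu> k, 1:])"
proof -
  obtain B P where sim: "similar_mat_wit A B P P\<^sup>T" and diag: "diagonal_mat B"
    using symmetric_real_diagonalization[OF assms] by blast
  note w = similar_mat_witD2[OF A sim]
  have B: "B \<in> carrier_mat n n" and P: "P \<in> carrier_mat n n" using w by auto
  have "A * P = P * B * (P\<^sup>T * P)"
    using w(3) B P by (simp add: assoc_mult_mat[of _ n n _ n _ n])
  then have AP: "A * P = P * B" using w(2) B P by simp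
  have off: "B $$ (i, j) = 0" if "i < n" "j < n" "i \<noteq> j" for i j
    using diag that B by (auto simp: diagonal_mat_def)
  show thesis
  proof (rule that[of "\<lambda>k i. P $$ (i, k)" "\<lambda>k. B $$ (k, k)"])
    fix k l assume kl: "k < n" "l < n"
    have "(P\<^sup>T * P) $$ (k, l) = (\<Sum>i<n. P $$ (i, k) * P $$ (i, l))"
      using kl P by (simp add: scalar_prod_def atLeast0LessThan)
    then show "(\<Sum>i<n. P $$ (i, k) * P $$ (i, l)) = (if k = l then 1 else 0)"
      using w(2) kl by simp
  next
    fix k i assume ki: "k < n" "i < n"
    have "(\<Sum>j<n. A $$ (i, j) * P $$ (j, k)) = (A * P) $$ (i, k)"
      using ki A P by (simp add: scalar_prod_def atLeast0LessThan)
    also have "\<dots> = (\<Sum>j<n. P $$ (i, j) * B $$ (j, k))"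
      unfolding AP using ki B P by (simp add: scalar_prod_def atLeast0LessThan)
    also have "\<dots> = (\<Sum>j<n. if j = k then P $$ (i, k) * B $$ (k, k) else 0)"
      using ki by (intro sum.cong) (auto simp: off)
    finally show "(\<Sum>j<n. A $$ (i, j) * P $$ (j, k)) = B $$ (k, k) * P $$ (i, k)"
      using ki by simp
  next
    have "upper_triangular B" using off B by auto
    then have "char_poly B = (\<Prod>a\<leftarrow>diag_mat B. [:- a, 1:])"
      by (rule char_poly_upper_triangular[OF B])
    also have "\<dots> = (\<Prod>k<n. [:- B $$ (k, k), 1:])"
      using B by (simp add: diag_mat_def prod.list_conv_set_nth atLeast0LessThan)
    finally show "char_poly A = (\<Prod>k<n. [:- B $$ (k, k), 1:])"
      using char_poly_similar[of A B] sim by (auto simp: similar_mat_def)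
  qed
qed

section \<open>Root multiplicities as index counts\<close>

lemma order_prod_linear:
  fixes \<mu> :: "'k \<Rightarrow> real"
  assumes "finite K"
  shows "order x (\<Prod>k\<in>K. [:- \<mu> k, 1:]) = card {k \<in> K. \<mu> k = x}"
  using assms
proof (induction K)
  case (insert a K)
  have "(\<Prod>k\<in>insert a K. [:- \<mu> k, 1:]) \<noteq> 0"
    using insert by (subst prod_zero_iff) auto
  then have "order x (\<Prod>k\<in>insert a K. [:- \<mu> k, 1:]) = order x [:- \<mu> a, 1:] + card {k \<in> K. \<mu> k = x}"
    using insert by (subst (asm) prod.insert, simp_all add: order_mult del: mult_pCons_left)
  also have "order x [:- \<mu> a, 1:] = (if \<mu> a = x then 1 else 0)"
    using order_power_n_n[of x 1] by (auto intro!: order_0I)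
  also have "(if \<mu> a = x then 1 else 0) + card {k \<in> K. \<mu> k = x} = card {k \<in> insert a K. \<mu> k = x}"
  proof (cases "\<mu> a = x")
    case True
    then have "{k \<in> insert a K. \<mu> k = x} = insert a {k \<in> K. \<mu> k = x}" by auto
    then show ?thesis using insert True by simp
  next
    case False
    then have "{k \<in> insert a K. \<mu> k = x} = {k \<in> K. \<mu> k = x}" by auto
    then show ?thesis using False by simp
  qed
  finally show ?case .
qed (simp add: order_0I)

text \<open>The indices with value in \<open>I\<close> are partitioned by that value, and the class
  of a root has as many elements as the order of the root.\<close>

lemma sum_order_prod_linear:
  fixes \<mu> :: "'k \<Rightarrow> real"
  assumes K: "finite K" and p: "p = (\<Prod>k\<in>K. [:- \<mu> k, 1:])"
  shows "(\<Sum>x\<in>{x \<in> I. poly p x = 0}. order x p) = card {k \<in> K. \<mu> k \<in> I}"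
proof -
  have roots: "{x \<in> I. poly p x = 0} = \<mu> ` {k \<in> K. \<mu> k \<in> I}"
    using K by (auto simp: p poly_prod)
  have "card {k \<in> K. \<mu> k \<in> I} = card (\<Union>x\<in>\<mu> ` {k \<in> K. \<mu> k \<in> I}. {k \<in> K. \<mu> k = x})"
    by (rule arg_cong[of _ _ card]) auto
  also have "\<dots> = (\<Sum>x\<in>\<mu> ` {k \<in> K. \<mu> k \<in> I}. card {k \<in> K. \<mu> k = x})"
    using K by (intro card_UN_disjoint) auto
  finally show ?thesis
    unfolding roots by (simp add: p order_prod_linear[OF K])
qed

text \<open>Gaussian elimination, one equation at a time: a pivot unknown \<open>m\<close> is
  eliminated from the other equations, which costs one equation and one unknown.\<close>

lemma homogeneous_system_nontrivial_solution:
  fixes \<phi> :: "'s \<Rightarrow> 'k \<Rightarrow> real"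
  assumes "finite S" "finite K" "card S < card K"
  shows "\<exists>z. (\<exists>k\<in>K. z k \<noteq> 0) \<and> (\<forall>s\<in>S. (\<Sum>k\<in>K. \<phi> s k * z k) = 0)"
  using assms
proof (induction S arbitrary: K \<phi>)
  case empty
  then show ?case by (intro exI[of _ "\<lambda>_. 1"]) (auto simp: card_gt_0_iff)
next
  case (insert s S)
  show ?case
  proof (cases "\<forall>k\<in>K. \<phi> s k = 0")
    case True
    moreover obtain z where "\<exists>k\<in>K. z k \<noteq> 0" "\<forall>s\<in>S. (\<Sum>k\<in>K. \<phi> s k * z k) = 0"
      using insert.IH[of K \<phi>] insert.prems insert.hyps by auto
    ultimately show ?thesis by (intro exI[of _ z]) auto
  next
    case False
    then obtain m where m: "m \<in> K" "\<phi> s m \<noteq> 0" by blast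
    let ?K = "K - {m}"
    have card: "card S < card ?K" using insert.prems insert.hyps m by auto
    obtain z where z: "\<exists>k\<in>?K. z k \<noteq> 0"
      "\<forall>t\<in>S. (\<Sum>k\<in>?K. (\<phi> t k - \<phi> t m * \<phi> s k / \<phi> s m) * z k) = 0"
      using insert.IH[of ?K "\<lambda>t k. \<phi> t k - \<phi> t m * \<phi> s k / \<phi> s m"] card
        insert.prems(1) by auto
    \<comment> \<open>Back substitution: the value at the pivot is the one that solves equation
      \<open>s\<close>.\<close>
    define y where "y = z(m := - (\<Sum>k\<in>?K. \<phi> s k * z k) / \<phi> s m)"
    have split: "(\<Sum>k\<in>K. \<phi> t k * y k) = \<phi> t m * y m + (\<Sum>k\<in>?K. \<phi> t k * z k)" for t
      using m insert.prems(1) by (subst sum.remove[of K m]) (auto simp: y_def intro!: sum.cong)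
    have "(\<Sum>k\<in>K. \<phi> s k * y k) = 0"
      unfolding split using m by (simp add: y_def)
    moreover have "(\<Sum>k\<in>K. \<phi> t k * y k) = 0" if "t \<in> S" for t
    proof -
      have "0 = (\<Sum>k\<in>?K. \<phi> t k * z k) - \<phi> t m / \<phi> s m * (\<Sum>k\<in>?K. \<phi> s k * z k)"
        using z(2)[rule_format, OF that]
        by (simp add: left_diff_distrib sum_subtractf sum_distrib_left mult.assoc)
      then show ?thesis unfolding split by (simp add: y_def)
    qed
    moreover have "\<exists>k\<in>K. y k \<noteq> 0" using z(1) by (auto simp: y_def)
    ultimately show ?thesis by blast
  qed
qed

section \<open>The Laplacian quadratic form and its eigenbasis\<close>

definition lap_form :: "nat \<Rightarrow> (nat \<Rightarrow> nat \<Rightarrow> bool) \<Rightarrow> (nat \<Rightarrow> real) \<Rightarrow> real" where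
  "lap_form n E x = (\<Sum>i<n. \<Sum>j<n. if E i j then (x i - x j)\<^sup>2 else 0) / 2"

lemma laplacian_quadratic_form:
  assumes "simple_graph n E"
  shows "(\<Sum>i<n. x i * (\<Sum>j<n. laplacian n E $$ (i, j) * x j)) = lap_form n E x"
proof -
  let ?e = "\<lambda>i j. if E i j then 1 else (0 :: real)"
  have sym: "?e i j = ?e j i" for i j using assms by (auto simp: simple_graph_def)
  have deg: "real (Defs.degree n E i) = (\<Sum>j<n. ?e i j)" for i
    by (simp add: Defs.degree_def sum.If_cases Int_def)
  have "(\<Sum>j<n. laplacian n E $$ (i, j) * x j) = (\<Sum>j<n. ?e i j * (x i - x j))" if "i < n" for i
  proof -
    have "(\<Sum>j<n. laplacian n E $$ (i, j) * x j)
      = (\<Sum>j<n. (if j = i then real (Defs.degree n E i) * x i else 0) - ?e i j * x j)"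
      using that by (intro sum.cong) (auto simp: laplacian_def left_diff_distrib)
    also have "\<dots> = (\<Sum>j<n. ?e i j) * x i - (\<Sum>j<n. ?e i j * x j)"
      using that by (simp add: sum_subtractf deg)
    finally show ?thesis
      by (simp add: sum_distrib_right right_diff_distrib sum_subtractf del: mult_cancel_right2)
  qed
  then have lhs: "(\<Sum>i<n. x i * (\<Sum>j<n. laplacian n E $$ (i, j) * x j))
      = (\<Sum>i<n. \<Sum>j<n. ?e i j * (x i * (x i - x j)))" (is "?L = ?S")
    by (auto simp: sum_distrib_left intro!: sum.cong)
  \<comment> \<open>Exchanging the names of the two ends of each edge and adding both versions
    completes the square.\<close>
  have "?S = (\<Sum>i<n. \<Sum>j<n. ?e i j * (x j * (x j - x i)))"
    by (subst sum.swap) (auto simp: sym intro!: sum.cong)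
  then have "2 * ?S = (\<Sum>i<n. \<Sum>j<n. ?e i j * (x i * (x i - x j)))
      + (\<Sum>i<n. \<Sum>j<n. ?e i j * (x j * (x j - x i)))"
    by simp
  also have "\<dots> = (\<Sum>i<n. \<Sum>j<n. if E i j then (x i - x j)\<^sup>2 else 0)"
    unfolding sum.distrib[symmetric]
    by (intro sum.cong) (auto simp: power2_eq_square algebra_simps)
  finally show ?thesis unfolding lhs lap_form_def by simp
qed

lemma sum_sum_square_diff:
  fixes x :: "'a \<Rightarrow> real"
  shows "(\<Sum>i\<in>K. \<Sum>j\<in>K. (x i - x j)\<^sup>2) = 2 * (real (card K) * (\<Sum>i\<in>K. (x i)\<^sup>2)) - 2 * (\<Sum>i\<in>K. x i)\<^sup>2"
proof -
  have "(\<Sum>i\<in>K. \<Sum>j\<in>K. (x i - x j)\<^sup>2) = (\<Sum>i\<in>K. \<Sum>j\<in>K. (x i)\<^sup>2 + (x j)\<^sup>2 - 2 * (x i * x j))"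
    by (intro sum.cong) (auto simp: power2_eq_square algebra_simps)
  also have "\<dots> = 2 * (real (card K) * (\<Sum>i\<in>K. (x i)\<^sup>2)) - 2 * (\<Sum>i\<in>K. x i)\<^sup>2"
    by (simp add: sum.distrib sum_subtractf sum_distrib_left[symmetric] power2_eq_square sum_product)
  finally show ?thesis .
qed

text \<open>Comparison with the complete graph, whose form is \<open>n\<close> times the squared
  norm minus the square of the sum of the entries. It yields the upper bound \<open>n\<close> for
  the eigenvalues.\<close>

lemma lap_form_le_order: "lap_form n E x \<le> real n * (\<Sum>i<n. (x i)\<^sup>2)"
proof -
  have "2 * lap_form n E x \<le> (\<Sum>i<n. \<Sum>j<n. (x i - x j)\<^sup>2)"
    unfolding lap_form_def by (auto intro!: sum_mono)
  also have "\<dots> \<le> 2 * (real n * (\<Sum>i<n. (x i)\<^sup>2))"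
    by (simp add: sum_sum_square_diff)
  finally show ?thesis by simp
qed

text \<open>In coordinates \<open>z\<close> with respect to an orthonormal eigenbasis, norm and form
  are diagonal on the span of any set \<open>K\<close> of eigenvectors. All later spectral arguments
  use only these facts.\<close>

lemma laplacian_eigenbasis:
  assumes "simple_graph n E"
  obtains \<mu> :: "nat \<Rightarrow> real" and u :: "nat \<Rightarrow> nat \<Rightarrow> real" where
    "\<And>z K. K \<subseteq> {..<n} \<Longrightarrow> (\<Sum>i<n. (\<Sum>k\<in>K. z k * u k i)\<^sup>2) = (\<Sum>k\<in>K. (z k)\<^sup>2)"
    "\<And>z K. K \<subseteq> {..<n} \<Longrightarrow> lap_form n E (\<lambda>i. \<Sum>k\<in>K. z k * u k i) = (\<Sum>k\<in>K. \<mu> k * (z k)\<^sup>2)"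
    "\<And>I. lap_count n E I = card {k. k < n \<and> \<mu> k \<in> I}"
    "\<And>k. k < n \<Longrightarrow> \<mu> k \<le> real n"
proof -
  let ?L = "laplacian n E"
  have L: "?L \<in> carrier_mat n n" by (simp add: laplacian_def)
  have sym: "?L\<^sup>T = ?L"
    using assms by (intro eq_matI) (auto simp: laplacian_def simple_graph_def)
  obtain \<mu> :: "nat \<Rightarrow> real" and u :: "nat \<Rightarrow> nat \<Rightarrow> real" where
    orth: "\<And>k l. k < n \<Longrightarrow> l < n \<Longrightarrow> (\<Sum>i<n. u k i * u l i) = (if k = l then 1 else 0)" and
    eig: "\<And>k i. k < n \<Longrightarrow> i < n \<Longrightarrow> (\<Sum>j<n. ?L $$ (i, j) * u k j) = \<mu> k * u k i" and
    cp: "char_poly ?L = (\<Prod>k<n. [:- \<mu> k, 1:])"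
    by (rule symmetric_real_orthonormal_eigenbasis[OF L sym]) blast
  have inner: "(\<Sum>i<n. (\<Sum>k\<in>K. y k * u k i) * (\<Sum>k\<in>K. z k * u k i)) = (\<Sum>k\<in>K. y k * z k)"
    if K: "K \<subseteq> {..<n}" for y z K
  proof -
    have fin: "finite K" using K finite_subset by blast
    have "(\<Sum>i<n. (\<Sum>k\<in>K. y k * u k i) * (\<Sum>k\<in>K. z k * u k i))
      = (\<Sum>i<n. \<Sum>k\<in>K. \<Sum>l\<in>K. y k * z l * (u k i * u l i))"
      by (simp add: sum_product ac_simps)
    also have "\<dots> = (\<Sum>k\<in>K. \<Sum>l\<in>K. y k * z l * (\<Sum>i<n. u k i * u l i))"
      by (subst sum.swap, rule sum.cong[OF refl], subst sum.swap) (simp add: sum_distrib_left)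
    also have "\<dots> = (\<Sum>k\<in>K. \<Sum>l\<in>K. if k = l then y k * z l else 0)"
      using K by (intro sum.cong) (auto simp: orth subset_eq)
    also have "\<dots> = (\<Sum>k\<in>K. y k * z k)" using fin by simp
    finally show ?thesis .
  qed
  have form: "lap_form n E (\<lambda>i. \<Sum>k\<in>K. z k * u k i) = (\<Sum>k\<in>K. \<mu> k * (z k)\<^sup>2)"
    if K: "K \<subseteq> {..<n}" for z K
  proof -
    have "(\<Sum>j<n. ?L $$ (i, j) * (\<Sum>k\<in>K. z k * u k j)) = (\<Sum>k\<in>K. (\<mu> k * z k) * u k i)"
      if i: "i < n" for i
    proof -
      have "(\<Sum>j<n. ?L $$ (i, j) * (\<Sum>k\<in>K. z k * u k j)) = (\<Sum>k\<in>K. z k * (\<Sum>j<n. ?L $$ (i, j) * u k j))"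
        unfolding sum_distrib_left by (subst sum.swap) (simp add: ac_simps)
      also have "\<dots> = (\<Sum>k\<in>K. (\<mu> k * z k) * u k i)"
        using K i by (intro sum.cong) (auto simp: eig subset_eq)
      finally show ?thesis .
    qed
    then have "(\<Sum>i<n. (\<Sum>k\<in>K. z k * u k i) * (\<Sum>j<n. ?L $$ (i, j) * (\<Sum>k\<in>K. z k * u k j)))
      = (\<Sum>k\<in>K. z k * (\<mu> k * z k))"
      using inner[OF K, of z "\<lambda>k. \<mu> k * z k"] by simp
    then show ?thesis
      unfolding laplacian_quadratic_form[OF assms] by (simp add: power2_eq_square ac_simps)
  qed
  have norm: "(\<Sum>i<n. (\<Sum>k\<in>K. z k * u k i)\<^sup>2) = (\<Sum>k\<in>K. (z k)\<^sup>2)" if "K \<subseteq> {..<n}" for z K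
    using inner[OF that, of z z] by (simp add: power2_eq_square)
  show thesis
  proof (rule that[OF norm form])
    show "lap_count n E I = card {k. k < n \<and> \<mu> k \<in> I}" for I
      unfolding lap_count_def using sum_order_prod_linear[OF _ cp, of I] by simp
    show "\<mu> k \<le> real n" if "k < n" for k
      using lap_form_le_order[of n E "\<lambda>i. \<Sum>k\<in>{k}. 1 * u k i"] form[of "{k}" "\<lambda>_. 1"]
        norm[of "{k}" "\<lambda>_. 1"] that by simp
  qed
qed

section \<open>Bounding eigenvalue counts in both directions\<close>

lemma constrained_combination:
  fixes \<phi> :: "'s \<Rightarrow> nat \<Rightarrow> real" and u :: "nat \<Rightarrow> nat \<Rightarrow> real"
  assumes "finite S" "finite K" "card S < card K"
  obtains z where "\<exists>k\<in>K. z k \<noteq> 0" "\<And>s. s \<in> S \<Longrightarrow> (\<Sum>i<n. \<phi> s i * (\<Sum>k\<in>K. z k * u k i)) = 0"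
proof -
  obtain z where z: "\<exists>k\<in>K. z k \<noteq> 0" "\<forall>s\<in>S. (\<Sum>k\<in>K. (\<Sum>i<n. \<phi> s i * u k i) * z k) = 0"
    using homogeneous_system_nontrivial_solution[OF assms, of "\<lambda>s k. \<Sum>i<n. \<phi> s i * u k i"] by blast
  have "(\<Sum>i<n. \<phi> s i * (\<Sum>k\<in>K. z k * u k i)) = (\<Sum>k\<in>K. (\<Sum>i<n. \<phi> s i * u k i) * z k)" for s
    unfolding sum_distrib_left sum_distrib_right by (subst sum.swap) (simp add: ac_simps)
  then show thesis using that z by simp
qed

text \<open>Used for upper bounds on the count: the span of the eigenvectors with eigenvalue at
  least \<open>c\<close> has larger dimension than there are constraints, so it contains a nonzero
  vector satisfying them all.\<close>

lemma exists_lap_form_ge: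
  fixes \<phi> :: "'s \<Rightarrow> nat \<Rightarrow> real"
  assumes "simple_graph n E" "finite S" "card S < lap_count n E {c..real n}"
  obtains x where "\<exists>i<n. x i \<noteq> 0" "\<And>s. s \<in> S \<Longrightarrow> (\<Sum>i<n. \<phi> s i * x i) = 0"
    "c * (\<Sum>i<n. (x i)\<^sup>2) \<le> lap_form n E x"
proof -
  obtain \<mu> :: "nat \<Rightarrow> real" and u :: "nat \<Rightarrow> nat \<Rightarrow> real" where
    norm: "\<And>z K. K \<subseteq> {..<n} \<Longrightarrow> (\<Sum>i<n. (\<Sum>k\<in>K. z k * u k i)\<^sup>2) = (\<Sum>k\<in>K. (z k)\<^sup>2)" and
    form: "\<And>z K. K \<subseteq> {..<n} \<Longrightarrow> lap_form n E (\<lambda>i. \<Sum>k\<in>K. z k * u k i) = (\<Sum>k\<in>K. \<mu> k * (z k)\<^sup>2)" and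
    cnt: "\<And>I. lap_count n E I = card {k. k < n \<and> \<mu> k \<in> I}"
    by (rule laplacian_eigenbasis[OF assms(1)]) blast
  define K where "K = {k. k < n \<and> \<mu> k \<in> {c..real n}}"
  have K: "K \<subseteq> {..<n}" "finite K" by (auto simp: K_def)
  obtain z where z: "\<exists>k\<in>K. z k \<noteq> 0" "\<And>s. s \<in> S \<Longrightarrow> (\<Sum>i<n. \<phi> s i * (\<Sum>k\<in>K. z k * u k i)) = 0"
    using constrained_combination[OF assms(2) K(2)] assms(3) unfolding cnt K_def by blast
  let ?x = "\<lambda>i. \<Sum>k\<in>K. z k * u k i"
  have pos: "0 < (\<Sum>k\<in>K. (z k)\<^sup>2)" using z(1) K(2) by (auto intro!: sum_pos2)
  show thesis
  proof (rule that[OF _ z(2)])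
    show "\<exists>i<n. ?x i \<noteq> 0"
    proof (rule ccontr)
      assume "\<not> ?thesis"
      then have "(\<Sum>i<n. (?x i)\<^sup>2) = 0" by simp
      then show False using norm[OF K(1), of z] pos by simp
    qed
    show "c * (\<Sum>i<n. (?x i)\<^sup>2) \<le> lap_form n E ?x"
      unfolding norm[OF K(1)] form[OF K(1)] sum_distrib_left
      by (intro sum_mono mult_right_mono) (auto simp: K_def)
  qed
qed

text \<open>The dual direction: more than \<open>card S\<close> eigenvalues below \<open>c\<close>
  would give a nonzero combination of their eigenvectors that satisfies the constraints and has form
  strictly below \<open>c\<close> times its squared norm. As no eigenvalue exceeds \<open>n\<close>,
  the others all lie in the interval.\<close>

lemma lap_count_ge:
  fixes \<phi> :: "'s \<Rightarrow> nat \<Rightarrow> real"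
  assumes "simple_graph n E" "finite S"
    and ge: "\<And>x. (\<And>s. s \<in> S \<Longrightarrow> (\<Sum>i<n. \<phi> s i * x i) = 0) \<Longrightarrow> c * (\<Sum>i<n. (x i)\<^sup>2) \<le> lap_form n E x"
  shows "n \<le> lap_count n E {c..real n} + card S"
proof -
  obtain \<mu> :: "nat \<Rightarrow> real" and u :: "nat \<Rightarrow> nat \<Rightarrow> real" where
    norm: "\<And>z K. K \<subseteq> {..<n} \<Longrightarrow> (\<Sum>i<n. (\<Sum>k\<in>K. z k * u k i)\<^sup>2) = (\<Sum>k\<in>K. (z k)\<^sup>2)" and
    form: "\<And>z K. K \<subseteq> {..<n} \<Longrightarrow> lap_form n E (\<lambda>i. \<Sum>k\<in>K. z k * u k i) = (\<Sum>k\<in>K. \<mu> k * (z k)\<^sup>2)" and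
    cnt: "\<And>I. lap_count n E I = card {k. k < n \<and> \<mu> k \<in> I}" and
    le: "\<And>k. k < n \<Longrightarrow> \<mu> k \<le> real n"
    by (rule laplacian_eigenbasis[OF assms(1)]) blast
  define K where "K = {k. k < n \<and> \<mu> k < c}"
  have K: "K \<subseteq> {..<n}" "finite K" by (auto simp: K_def)
  have "card K \<le> card S"
  proof (rule ccontr)
    assume "\<not> ?thesis"
    then have "card S < card K" by simp
    then obtain z where z: "\<exists>k\<in>K. z k \<noteq> 0" "\<And>s. s \<in> S \<Longrightarrow> (\<Sum>i<n. \<phi> s i * (\<Sum>k\<in>K. z k * u k i)) = 0"
      using constrained_combination[OF assms(2) K(2)] by blast
    have "c * (\<Sum>k\<in>K. (z k)\<^sup>2) \<le> (\<Sum>k\<in>K. \<mu> k * (z k)\<^sup>2)"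
      using ge[OF z(2)] unfolding norm[OF K(1)] form[OF K(1)] by simp
    moreover have "(\<Sum>k\<in>K. \<mu> k * (z k)\<^sup>2) < c * (\<Sum>k\<in>K. (z k)\<^sup>2)"
      unfolding sum_distrib_left
    proof (rule sum_strict_mono_ex1[OF K(2)])
      show "\<forall>k\<in>K. \<mu> k * (z k)\<^sup>2 \<le> c * (z k)\<^sup>2"
        by (auto simp: K_def intro!: mult_right_mono)
      show "\<exists>k\<in>K. \<mu> k * (z k)\<^sup>2 < c * (z k)\<^sup>2"
        using z(1) by (auto simp: K_def)
    qed
    ultimately show False by simp
  qed
  moreover have "card {k. k < n \<and> \<mu> k \<in> {c..real n}} + card K = n"
  proof -
    have "{k. k < n \<and> \<mu> k \<in> {c..real n}} \<union> K = {..<n}" using le by (auto simp: K_def)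
    moreover have "{k. k < n \<and> \<mu> k \<in> {c..real n}} \<inter> K = {}" by (auto simp: K_def)
    ultimately show ?thesis using K(2) by (subst card_Un_disjoint[symmetric]) auto
  qed
  ultimately show ?thesis unfolding cnt by simp
qed

section \<open>The gap along a geodesic\<close>

lemma sum_path_adjacent:
  fixes x :: "nat \<Rightarrow> real"
  shows "(\<Sum>i\<le>d. \<Sum>j\<le>d. if i + 1 = j \<or> j + 1 = i then (x i - x j)\<^sup>2 else 0)
    = 2 * (\<Sum>i<d. (x i - x (Suc i))\<^sup>2)"
proof (induction d)
  case (Suc d)
  let ?g = "\<lambda>i j. if i + 1 = j \<or> j + 1 = i then (x i - x j)\<^sup>2 else 0"
  have "(\<Sum>i\<le>d. ?g i (Suc d)) = (\<Sum>i\<le>d. if i = d then (x d - x (Suc d))\<^sup>2 else 0)"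
    by (intro sum.cong) auto
  moreover have "(\<Sum>j\<le>d. ?g (Suc d) j) = (\<Sum>j\<le>d. if j = d then (x d - x (Suc d))\<^sup>2 else 0)"
    by (intro sum.cong) (auto simp: power2_commute)
  ultimately show ?case using Suc.IH by (simp add: sum.distrib)
qed simp

text \<open>On each path edge the squares of difference and sum add up to twice the two squared
  values. Inner vertices lie on two edges, the ends on one, which produces the correction terms at
  \<open>0\<close> and \<open>d\<close>.\<close>

lemma sum_path_differences:
  fixes x :: "nat \<Rightarrow> real"
  shows "(\<Sum>i<d. (x i - x (Suc i))\<^sup>2)
    = 4 * (\<Sum>i\<le>d. (x i)\<^sup>2) - 2 * (x 0)\<^sup>2 - 2 * (x d)\<^sup>2 - (\<Sum>i<d. (x i + x (Suc i))\<^sup>2)"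
  by (induction d) (auto simp: power2_eq_square algebra_simps)

lemma sum_sum_symmetric_Un3:
  fixes g :: "'a \<Rightarrow> 'a \<Rightarrow> real"
  assumes fin: "finite A" "finite B" "finite C" and dis: "A \<inter> B = {}" "A \<inter> C = {}" "B \<inter> C = {}"
    and sym: "\<And>i j. g i j = g j i"
  shows "(\<Sum>i\<in>A \<union> B \<union> C. \<Sum>j\<in>A \<union> B \<union> C. g i j)
    = (\<Sum>i\<in>A. \<Sum>j\<in>A. g i j) + (\<Sum>i\<in>B. \<Sum>j\<in>B. g i j) + (\<Sum>i\<in>C. \<Sum>j\<in>C. g i j)
      + 2 * (\<Sum>i\<in>B. \<Sum>j\<in>A. g i j) + 2 * (\<Sum>i\<in>C. \<Sum>j\<in>A. g i j) + 2 * (\<Sum>i\<in>C. \<Sum>j\<in>B. g i j)"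
proof -
  have sw: "(\<Sum>i\<in>X. \<Sum>j\<in>Y. g i j) = (\<Sum>i\<in>Y. \<Sum>j\<in>X. g i j)" for X Y
    by (subst sum.swap) (simp add: sym)
  have split: "(\<Sum>j\<in>A \<union> B \<union> C. h j) = (\<Sum>j\<in>A. h j) + (\<Sum>j\<in>B. h j) + (\<Sum>j\<in>C. h j)" for h :: "'a \<Rightarrow> real"
    using fin dis by (subst sum.union_disjoint, auto)+
  show ?thesis
    unfolding split sum.distrib sw[of A B] sw[of A C] sw[of B C] by simp
qed

lemma sum_indicator_mult:
  fixes x :: "nat \<Rightarrow> real"
  assumes "k < n"
  shows "(\<Sum>i<n. (if i = k then 1 else 0) * x i) = x k"
proof -
  have "(\<Sum>i<n. (if i = k then 1 else 0) * x i) = (\<Sum>i<n. if i = k then x k else 0)"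
    by (intro sum.cong) auto
  then show ?thesis using assms by simp
qed

text \<open>The normal form of the graph: an induced diametral path occupies \<open>0..d\<close>,
  and at least one vertex lies off it. The hypothesis \<open>window\<close> records that a vertex
  off the path cannot provide a shortcut.\<close>

locale geodesic_labelling =
  fixes n d :: nat and E :: "nat \<Rightarrow> nat \<Rightarrow> bool"
  assumes simple: "simple_graph n E" and d2: "2 \<le> d" and dn: "d + 2 \<le> n"
    and path: "\<And>i j. i \<le> d \<Longrightarrow> j \<le> d \<Longrightarrow> E i j \<longleftrightarrow> i + 1 = j \<or> j + 1 = i"
    and window: "\<And>w i j. d < w \<Longrightarrow> i \<le> d \<Longrightarrow> j \<le> d \<Longrightarrow> E w i \<Longrightarrow> E w j \<Longrightarrow> j \<le> i + 2"
begin

lemma sym: "E i j \<longleftrightarrow> E j i" and irrefl: "\<not> E i i"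
  using simple by (auto simp: simple_graph_def)

lemma neighbours_in_triple:
  assumes "d < w"
  obtains t where "1 \<le> t" "t < d" "\<And>i. i \<le> d \<Longrightarrow> E w i \<Longrightarrow> i \<in> {t - 1, t, t + 1}"
proof (cases "\<exists>i\<le>d. E w i")
  case True
  define m where "m = (LEAST i. i \<le> d \<and> E w i)"
  have m: "m \<le> d" "E w m" using LeastI_ex[OF True] by (auto simp: m_def)
  have "m \<le> i" "i \<le> m + 2" if "i \<le> d" "E w i" for i
    using that m window[OF assms m(1) that(1)] by (auto simp: m_def intro: Least_le)
  \<comment> \<open>The triple starts at the smallest neighbour \<open>m\<close>; its centre is
    capped at \<open>d - 1\<close> so that it stays on the path when \<open>m\<close> is near the
    end.\<close>
  then show thesis using that[of "min (m + 1) (d - 1)"] d2 m(1)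
    by (cases "m + 1 < d") fastforce+
next
  case False
  then show thesis using that[of 1] d2 by auto
qed

text \<open>Writing the gap as a sum of squares is possible because the edges from \<open>w\<close> to its triple,
  where \<open>x w = - x t\<close>, cancel exactly the signless path terms at \<open>t\<close>.\<close>
lemma lap_form_gap:
  assumes w: "d < w" "w < n" and t: "1 \<le> t" "t < d"
    and nbr: "\<And>i. i \<le> d \<Longrightarrow> E w i \<Longrightarrow> i \<in> {t - 1, t, t + 1}"
    and supp: "\<And>u. d < u \<Longrightarrow> u < n \<Longrightarrow> u \<noteq> w \<Longrightarrow> x u = 0" and xw: "x w = - x t"
  shows "(real n - real d + 2) * (\<Sum>i<n. (x i)\<^sup>2) - lap_form n E x
    = 2 * (x 0)\<^sup>2 + 2 * (x d)\<^sup>2 + (\<Sum>i\<in>{..<d} - {t - 1, t}. (x i + x (Suc i))\<^sup>2)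
      + (\<Sum>i\<in>{t - 1, t, t + 1}. if E w i then 0 else (x i - x w)\<^sup>2)
      + (\<Sum>u\<in>{d<..<n} - {w}. (\<Sum>i\<le>d. if E u i then 0 else (x i)\<^sup>2) + (if E u w then 0 else (x w)\<^sup>2))"
proof -
  define R where "R = {d<..<n} - {w}"
  define N where "N = (\<Sum>i\<le>d. (x i)\<^sup>2)"
  have V: "{..<n} = {..d} \<union> {w} \<union> R" using w by (auto simp: R_def)
  have fin: "finite R" by (simp add: R_def)
  have dis: "{..d} \<inter> {w} = {}" "{..d} \<inter> R = {}" "{w} \<inter> R = {}" using w by (auto simp: R_def)
  have x0: "x u = 0" if "u \<in> R" for u using supp that by (auto simp: R_def)
  have norm: "(\<Sum>i<n. (x i)\<^sup>2) = N + (x w)\<^sup>2"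
    unfolding V using fin dis by (subst sum.union_disjoint; auto simp: x0 N_def)+
  have cardR: "real (card R) = real n - real d - 2"
    using w dn by (simp add: R_def card_Diff_singleton of_nat_diff)
  let ?g = "\<lambda>i j. if E i j then (x i - x j)\<^sup>2 else 0"
  have "2 * lap_form n E x = (\<Sum>i\<le>d. \<Sum>j\<le>d. ?g i j) + 2 * (\<Sum>j\<le>d. ?g w j)
      + 2 * (\<Sum>u\<in>R. \<Sum>i\<le>d. ?g u i) + 2 * (\<Sum>u\<in>R. ?g u w)"
  proof -
    have "2 * lap_form n E x = (\<Sum>i\<in>{..d} \<union> {w} \<union> R. \<Sum>j\<in>{..d} \<union> {w} \<union> R. ?g i j)"
      unfolding lap_form_def V by simp
    also have "\<dots> = (\<Sum>i\<le>d. \<Sum>j\<le>d. ?g i j) + (\<Sum>i\<in>{w}. \<Sum>j\<in>{w}. ?g i j) + (\<Sum>i\<in>R. \<Sum>j\<in>R. ?g i j)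
      + 2 * (\<Sum>i\<in>{w}. \<Sum>j\<le>d. ?g i j) + 2 * (\<Sum>i\<in>R. \<Sum>j\<le>d. ?g i j) + 2 * (\<Sum>i\<in>R. \<Sum>j\<in>{w}. ?g i j)"
      using fin dis by (intro sum_sum_symmetric_Un3) (auto simp: sym power2_commute)
    finally show ?thesis by (simp add: x0 irrefl)
  qed
  moreover have "(\<Sum>i\<le>d. \<Sum>j\<le>d. ?g i j) = 2 * (\<Sum>i<d. (x i - x (Suc i))\<^sup>2)"
    unfolding sum_path_adjacent[symmetric] by (intro sum.cong) (auto simp: path)
  \<comment> \<open>Since \<open>x\<close> vanishes on \<open>R\<close>, a present edge from
    \<open>u\<close> to \<open>i\<close> contributes the square of \<open>x i\<close>. Counting all
    pairs and subtracting the missing ones produces the penalty terms; the same is done next for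
    edges to \<open>w\<close>.\<close>
  moreover have "(\<Sum>u\<in>R. \<Sum>i\<le>d. ?g u i) = real (card R) * N - (\<Sum>u\<in>R. \<Sum>i\<le>d. if E u i then 0 else (x i)\<^sup>2)"
  proof -
    have "(\<Sum>u\<in>R. \<Sum>i\<le>d. ?g u i) = (\<Sum>u\<in>R. \<Sum>i\<le>d. (x i)\<^sup>2 - (if E u i then 0 else (x i)\<^sup>2))"
      by (intro sum.cong) (auto simp: x0)
    then show ?thesis by (simp add: sum_subtractf N_def)
  qed
  moreover have "(\<Sum>u\<in>R. ?g u w) = real (card R) * (x w)\<^sup>2 - (\<Sum>u\<in>R. if E u w then 0 else (x w)\<^sup>2)"
  proof -
    have "(\<Sum>u\<in>R. ?g u w) = (\<Sum>u\<in>R. (x w)\<^sup>2 - (if E u w then 0 else (x w)\<^sup>2))"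
      by (intro sum.cong) (auto simp: x0)
    then show ?thesis by (simp add: sum_subtractf)
  qed
  moreover have "(\<Sum>j\<le>d. ?g w j) = (\<Sum>i\<in>{t - 1, t, t + 1}. (x i - x w)\<^sup>2)
      - (\<Sum>i\<in>{t - 1, t, t + 1}. if E w i then 0 else (x i - x w)\<^sup>2)"
  proof -
    have "(\<Sum>j\<le>d. ?g w j) = (\<Sum>j\<in>{t - 1, t, t + 1}. ?g w j)"
      using t nbr by (intro sum.mono_neutral_right) (auto simp: power2_commute)
    also have "\<dots> = (\<Sum>i\<in>{t - 1, t, t + 1}. (x i - x w)\<^sup>2 - (if E w i then 0 else (x i - x w)\<^sup>2))"
      by (intro sum.cong) (auto simp: power2_commute)
    finally show ?thesis by (simp only: sum_subtractf)
  qed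
  moreover have "(\<Sum>i\<in>{t - 1, t, t + 1}. (x i - x w)\<^sup>2)
      = (x (t - 1) + x t)\<^sup>2 + 4 * (x t)\<^sup>2 + (x t + x (t + 1))\<^sup>2"
  proof -
    have "t - 1 \<noteq> t" "t - 1 \<noteq> t + 1" using t by auto
    then show ?thesis using xw by (simp add: power2_eq_square algebra_simps)
  qed
  moreover have "(\<Sum>i<d. (x i + x (Suc i))\<^sup>2) = (x (t - 1) + x t)\<^sup>2 + (x t + x (t + 1))\<^sup>2
      + (\<Sum>i\<in>{..<d} - {t - 1, t}. (x i + x (Suc i))\<^sup>2)"
  proof -
    have "t - 1 \<noteq> t" "Suc (t - 1) = t" "{t - 1, t} \<subseteq> {..<d}" using t by auto
    then show ?thesis
      by (subst sum.subset_diff[of "{t - 1, t}"]) (auto simp: add.commute)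
  qed
  moreover note sum_path_differences[of x d, folded N_def]
  moreover have "(x w)\<^sup>2 = (x t)\<^sup>2" by (simp add: xw)
  \<comment> \<open>The factor is \<open>card R + 4\<close>. The part \<open>card R\<close> matches
    the edges at \<open>R\<close>; the remaining \<open>4 * N\<close> comes from the path
    differences, and four times the square of \<open>x w\<close> from the edge between
    \<open>w\<close> and \<open>t\<close>.\<close>
  moreover have "(real n - real d + 2) * (\<Sum>i<n. (x i)\<^sup>2)
      = real (card R) * N + real (card R) * (x w)\<^sup>2 + 4 * N + 4 * (x w)\<^sup>2"
    unfolding norm cardR by (simp add: algebra_simps)
  ultimately show ?thesis
    unfolding R_def[symmetric] sum.distrib by linarith
qed

text \<open>A sum of squares that is at most \<open>0\<close> vanishes term by term. The path terms
  then confine \<open>x\<close> to \<open>t\<close> and \<open>w\<close>, and each missing-edge term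
  with a nonzero value there forces the edge to exist.\<close>

lemma lap_form_large:
  assumes w: "d < w" "w < n" and t: "1 \<le> t" "t < d"
    and nbr: "\<And>i. i \<le> d \<Longrightarrow> E w i \<Longrightarrow> i \<in> {t - 1, t, t + 1}"
    and supp: "\<And>u. d < u \<Longrightarrow> u < n \<Longrightarrow> u \<noteq> w \<Longrightarrow> x u = 0" and xw: "x w = - x t"
    and nz: "\<exists>i<n. x i \<noteq> 0"
    and large: "(real n - real d + 2) * (\<Sum>i<n. (x i)\<^sup>2) \<le> lap_form n E x"
  shows "x w \<noteq> 0" "E w (t - 1)" "E w t" "E w (t + 1)"
    "\<And>u. d < u \<Longrightarrow> u < n \<Longrightarrow> u \<noteq> w \<Longrightarrow> E u w \<and> E u t"
proof -
  let ?a = "\<Sum>i\<in>{..<d} - {t - 1, t}. (x i + x (Suc i))\<^sup>2"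
  let ?b = "\<Sum>i\<in>{t - 1, t, t + 1}. if E w i then 0 else (x i - x w)\<^sup>2"
  let ?h = "\<lambda>u. (\<Sum>i\<le>d. if E u i then 0 else (x i)\<^sup>2) + (if E u w then 0 else (x w)\<^sup>2)"
  let ?c = "\<Sum>u\<in>{d<..<n} - {w}. ?h u"
  have h: "0 \<le> ?h u" for u by (auto intro!: add_nonneg_nonneg sum_nonneg)
  have "0 \<le> ?a" "0 \<le> ?b" "0 \<le> ?c" by (intro sum_nonneg; auto intro!: add_nonneg_nonneg sum_nonneg)+
  moreover have "2 * (x 0)\<^sup>2 + 2 * (x d)\<^sup>2 + ?a + ?b + ?c \<le> 0"
    using lap_form_gap[OF w t nbr supp xw] large by linarith
  moreover have "0 \<le> (x 0)\<^sup>2" "0 \<le> (x d)\<^sup>2" by auto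
  ultimately have z: "(x 0)\<^sup>2 = 0" "(x d)\<^sup>2 = 0" "?a = 0" "?b = 0" "?c = 0" by linarith+
  have a: "x i + x (Suc i) = 0" if "i < d" "i \<noteq> t - 1" "i \<noteq> t" for i
    using z(3) that by (subst (asm) sum_nonneg_eq_0_iff) auto
  \<comment> \<open>The value \<open>0\<close> spreads from the end \<open>0\<close> up to
    \<open>t - 1\<close>, and in \<open>hi\<close> from the end \<open>d\<close> down to
    \<open>t + 1\<close>. It stops there because the two path edges at \<open>t\<close> carry no
    square in the gap.\<close>
  have lo: "x i = 0" if "i \<le> t - 1" for i
    using that
  proof (induction i)
    case 0
    then show ?case using z(1) by simp
  next
    case (Suc i)
    then show ?case using a[of i] t by simp
  qed
  have hi: "x (d - i) = 0" if "i < d - t" for i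
    using that
  proof (induction i)
    case 0
    then show ?case using z(2) by simp
  next
    case (Suc i)
    then have "Suc (d - Suc i) = d - i" by simp
    then show ?case using Suc a[of "d - Suc i"] t by simp
  qed
  have off: "x i = 0" if "i \<le> d" "i \<noteq> t" for i
    using lo[of i] hi[of "d - i"] that t by (cases "i < t") auto
  show xw0: "x w \<noteq> 0"
  proof
    assume "x w = 0"
    then have "x i = 0" if "i < n" for i
      using off[of i] supp[of i] xw that by (cases "i \<le> d"; cases "i = t"; cases "i = w") auto
    then show False using nz by blast
  qed
  have b: "E w i" if "i \<in> {t - 1, t, t + 1}" "x i \<noteq> x w" for i
    using z(4) that by (subst (asm) sum_nonneg_eq_0_iff) (auto split: if_splits)
  \<comment> \<open>On the triple \<open>x\<close> takes the values \<open>0\<close>,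
    \<open>- x w\<close> and \<open>0\<close>, all different from the nonzero
    \<open>x w\<close>.\<close>
  show "E w (t - 1)" "E w t" "E w (t + 1)"
    using b off[of "t - 1"] off[of "t + 1"] xw0 xw t by auto
  fix u assume u: "d < u" "u < n" "u \<noteq> w"
  have hu: "?h u = 0"
    using z(5) u h by (subst (asm) sum_nonneg_eq_0_iff) auto
  have s: "0 \<le> (\<Sum>i\<le>d. if E u i then 0 else (x i)\<^sup>2)" by (intro sum_nonneg) auto
  have "(if E u w then 0 else (x w)\<^sup>2) = 0" "(\<Sum>i\<le>d. if E u i then 0 else (x i)\<^sup>2) = 0"
    using hu s zero_le_power2[of "x w"] by (smt (verit))+
  moreover have "E u t" if "(\<Sum>i\<le>d. if E u i then 0 else (x i)\<^sup>2) = 0"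
    using that t xw xw0 by (subst (asm) sum_nonneg_eq_0_iff) (auto split: if_splits)
  ultimately show "E u w \<and> E u t" using xw0 by (auto split: if_splits)
qed

text \<open>The constraints \<open>x = 0\<close> off \<open>{0..d} \<union> {w}\<close> are indexed by the vertices \<open>u\<close> concerned,
  \<open>x w + x t = 0\<close> by \<open>0\<close>, and \<open>x w = 0\<close> by \<open>1\<close>.\<close>
definition test_constraint :: "nat \<Rightarrow> nat \<Rightarrow> nat \<Rightarrow> nat \<Rightarrow> real" where
  "test_constraint w t s i = (if s = 0 then (if i = w \<or> i = t then 1 else 0)
     else if s = 1 then (if i = w then 1 else 0) else (if i = s then 1 else 0))"

text \<open>The support condition costs \<open>n - d - 2\<close> constraints. The set
  \<open>S\<close> selects the others: both for the bound, only \<open>0\<close> for the equality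
  case.\<close>

lemma test_vector:
  assumes w: "d < w" "w < n" and t: "1 \<le> t" "t < d"
    and S: "S \<subseteq> {..1 :: nat}" "0 \<in> S"
    and big: "n - d - 2 + card S < lap_count n E {real n - real d + 2..real n}"
  obtains x where "\<exists>i<n. x i \<noteq> 0" "\<And>u. d < u \<Longrightarrow> u < n \<Longrightarrow> u \<noteq> w \<Longrightarrow> x u = 0" "x w = - x t"
    "1 \<in> S \<Longrightarrow> x w = 0" "(real n - real d + 2) * (\<Sum>i<n. (x i)\<^sup>2) \<le> lap_form n E x"
proof -
  let ?S = "S \<union> ({d<..<n} - {w})"
  have fS: "finite S" using S finite_subset by blast
  \<comment> \<open>The labels \<open>0\<close> and \<open>1\<close> lie below \<open>d\<close>, so
    they do not collide with the vertices used as labels.\<close>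
  have "S \<inter> ({d<..<n} - {w}) = {}" using S d2 by auto
  then have "card ?S = n - d - 2 + card S"
    using w fS by (subst card_Un_disjoint) (auto simp: card_Diff_singleton)
  then have "card ?S < lap_count n E {real n - real d + 2..real n}" "finite ?S" using big fS by auto
  then obtain x where x: "\<exists>i<n. x i \<noteq> 0" "\<And>s. s \<in> ?S \<Longrightarrow> (\<Sum>i<n. test_constraint w t s i * x i) = 0"
    "(real n - real d + 2) * (\<Sum>i<n. (x i)\<^sup>2) \<le> lap_form n E x"
    by (elim exists_lap_form_ge[OF simple, rotated, where \<phi> = "test_constraint w t"]) blast
  note single = sum_indicator_mult[of _ n x]
  show thesis
  proof (rule that[OF x(1) _ _ _ x(3)])
    fix u assume u: "d < u" "u < n" "u \<noteq> w"
    then show "x u = 0" using x(2)[of u] single[of u] d2 by (simp add: test_constraint_def)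
  next
    have "(\<Sum>i<n. test_constraint w t 0 i * x i)
      = (\<Sum>i<n. (if i = w then 1 else 0) * x i) + (\<Sum>i<n. (if i = t then 1 else 0) * x i)"
      unfolding sum.distrib[symmetric] using w t
      by (intro sum.cong) (auto simp: test_constraint_def)
    then show "x w = - x t" using x(2)[of 0] single[of w] single[of t] w t dn S(2) by simp
  next
    assume "1 \<in> S"
    then show "x w = 0" using x(2)[of 1] single[of w] w by (simp add: test_constraint_def)
  qed
qed

text \<open>With \<open>n - d\<close> constraints, one of them \<open>x w = 0\<close>, a larger
  count would give a nonzero vector contradicting \<open>lap_form_large\<close>. The vertex
  \<open>d + 1\<close> serves as a vertex off the path.\<close>

lemma lap_count_le: "lap_count n E {real n - real d + 2..real n} \<le> n - d"
proof (rule ccontr)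
  assume *: "\<not> ?thesis"
  have w: "d < d + 1" "d + 1 < n" using dn by auto
  obtain t where t: "1 \<le> t" "t < d" "\<And>i. i \<le> d \<Longrightarrow> E (d + 1) i \<Longrightarrow> i \<in> {t - 1, t, t + 1}"
    using neighbours_in_triple[OF w(1)] by blast
  have "n - d - 2 + card {0, 1 :: nat} < lap_count n E {real n - real d + 2..real n}"
    using * dn by simp
  from test_vector[OF w t(1,2) _ _ this] obtain x where
    x: "\<exists>i<n. x i \<noteq> 0" "\<And>u. d < u \<Longrightarrow> u < n \<Longrightarrow> u \<noteq> d + 1 \<Longrightarrow> x u = 0"
    "x (d + 1) = - x t" "x (d + 1) = 0"
    "(real n - real d + 2) * (\<Sum>i<n. (x i)\<^sup>2) \<le> lap_form n E x"
    by auto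
  from lap_form_large(1)[OF w t x(2) x(3) x(1) x(5)] x(4) show False by blast
qed

text \<open>Dropping \<open>x w = 0\<close> leaves \<open>n - d - 1\<close> constraints, one fewer
  than the count, so a test vector exists for every \<open>w\<close> off the path and its
  adjacencies can be read off.\<close>

lemma equality_structure:
  assumes eq: "lap_count n E {real n - real d + 2..real n} = n - d" and w: "d < w" "w < n"
  obtains t where "1 \<le> t" "t < d" "\<And>i. i \<le> d \<Longrightarrow> E w i \<longleftrightarrow> i \<in> {t - 1, t, t + 1}"
    "\<And>u. d < u \<Longrightarrow> u < n \<Longrightarrow> u \<noteq> w \<Longrightarrow> E u w \<and> E u t"
proof -
  obtain t where t: "1 \<le> t" "t < d" "\<And>i. i \<le> d \<Longrightarrow> E w i \<Longrightarrow> i \<in> {t - 1, t, t + 1}"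
    using neighbours_in_triple[OF w(1)] by blast
  have "n - d - 2 + card {0 :: nat} < lap_count n E {real n - real d + 2..real n}"
    using eq dn by simp
  from test_vector[OF w t(1,2) _ _ this] obtain x where
    x: "\<exists>i<n. x i \<noteq> 0" "\<And>u. d < u \<Longrightarrow> u < n \<Longrightarrow> u \<noteq> w \<Longrightarrow> x u = 0"
    "x w = - x t" "(real n - real d + 2) * (\<Sum>i<n. (x i)\<^sup>2) \<le> lap_form n E x"
    by auto
  note large = lap_form_large[OF w t x(2) x(3) x(1) x(4)]
  show thesis
  proof (rule that[OF t(1,2)])
    show "E w i \<longleftrightarrow> i \<in> {t - 1, t, t + 1}" if "i \<le> d" for i
      using large t(3)[OF that] by auto
  qed (use large(5) in blast)
qed

end

section \<open>Isomorphism invariance and the extremal graphs\<close>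

lemma graph_iso_sym:
  assumes "graph_iso n E m F"
  shows "graph_iso m F n E"
proof -
  obtain f where f: "bij_betw f {0..<n} {0..<m}" and EF: "\<forall>i<n. \<forall>j<n. E i j \<longleftrightarrow> F (f i) (f j)"
    using assms by (auto simp: graph_iso_def)
  let ?g = "inv_into {0..<n} f"
  have g: "bij_betw ?g {0..<m} {0..<n}" using f by (rule bij_betw_inv_into)
  have "?g i < n" "f (?g i) = i" if "i < m" for i
    using that bij_betw_apply[OF g, of i] bij_betw_inv_into_right[OF f, of i] by auto
  then have "\<forall>i<m. \<forall>j<m. F i j \<longleftrightarrow> E (?g i) (?g j)" using EF by simp
  then show ?thesis using g unfolding graph_iso_def by blast
qed

lemma graph_iso_trans:
  assumes "graph_iso n E m F" "graph_iso m F k G"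
  shows "graph_iso n E k G"
proof -
  obtain f where f: "bij_betw f {0..<n} {0..<m}" and EF: "\<forall>i<n. \<forall>j<n. E i j \<longleftrightarrow> F (f i) (f j)"
    using assms(1) by (auto simp: graph_iso_def)
  obtain g where g: "bij_betw g {0..<m} {0..<k}" and FG: "\<forall>i<m. \<forall>j<m. F i j \<longleftrightarrow> G (g i) (g j)"
    using assms(2) by (auto simp: graph_iso_def)
  have "f i < m" if "i < n" for i using that bij_betw_apply[OF f, of i] by simp
  then have "\<forall>i<n. \<forall>j<n. E i j \<longleftrightarrow> G ((g \<circ> f) i) ((g \<circ> f) j)" using EF FG by simp
  then show ?thesis using bij_betw_trans[OF f g] unfolding graph_iso_def by blast
qed

text \<open>The permutation matrix of the isomorphism conjugates one Laplacian into the other, so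
  the characteristic polynomials agree.\<close>

lemma lap_count_graph_iso:
  assumes "graph_iso n E n F"
  shows "lap_count n E I = lap_count n F I"
proof -
  obtain g where g: "bij_betw g {0..<n} {0..<n}" and EF: "\<And>i j. i < n \<Longrightarrow> j < n \<Longrightarrow> E i j \<longleftrightarrow> F (g i) (g j)"
    using assms by (auto simp: graph_iso_def)
  have gn: "g i < n" if "i < n" for i using that bij_betw_apply[OF g, of i] by simp
  have gi: "g i = g j \<longleftrightarrow> i = j" if "i < n" "j < n" for i j
    using that g by (auto simp: bij_betw_def inj_on_def)
  define P where "P = mat n n (\<lambda>(i, k). if k = g i then 1 else (0 :: real))"
  have P: "P \<in> carrier_mat n n" by (simp add: P_def)
  have L: "laplacian n F \<in> carrier_mat n n" "laplacian n E \<in> carrier_mat n n"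
    by (auto simp: laplacian_def)
  have row: "(\<Sum>k = 0..<n. (if k = g i then 1 else 0) * y k) = y (g i)"
    if "i < n" for i and y :: "nat \<Rightarrow> real"
    using sum_indicator_mult[OF gn[OF that], of y] by (simp add: atLeast0LessThan)
  have PPT: "P * P\<^sup>T = 1\<^sub>m n"
  proof (rule eq_matI)
    fix i j assume "i < dim_row (1\<^sub>m n :: real mat)" "j < dim_col (1\<^sub>m n :: real mat)"
    then have ij: "i < n" "j < n" by auto
    have "(P * P\<^sup>T) $$ (i, j) = (\<Sum>k = 0..<n. (if k = g i then 1 else 0) * (if k = g j then 1 else 0))"
      using ij by (simp add: P_def scalar_prod_def)
    also have "\<dots> = (if g i = g j then 1 else 0)" by (rule row[OF ij(1)])
    finally show "(P * P\<^sup>T) $$ (i, j) = 1\<^sub>m n $$ (i, j)" using ij by (simp add: gi)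
  qed (auto simp: P_def)
  have deg: "Defs.degree n F (g i) = Defs.degree n E i" if i: "i < n" for i
  proof -
    have "g ` {k. k < n \<and> E i k} = {k. k < n \<and> F (g i) k}"
    proof (intro equalityI subsetI)
      fix k assume "k \<in> {k. k < n \<and> F (g i) k}"
      then have k: "k < n" "F (g i) k" by auto
      then have "k \<in> g ` {0..<n}" using bij_betw_imp_surj_on[OF g] by simp
      then obtain l where "l < n" "k = g l" by auto
      then show "k \<in> g ` {k. k < n \<and> E i k}" using EF[OF i] k by blast
    qed (use EF[OF i] gn in auto)
    then have "bij_betw g {k. k < n \<and> E i k} {k. k < n \<and> F (g i) k}"
      by (rule bij_betw_subset[OF g, rotated]) auto
    then show ?thesis by (simp add: Defs.degree_def bij_betw_same_card)
  qed
  have "laplacian n E = P * laplacian n F * P\<^sup>T"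
  proof (rule eq_matI)
    fix i j assume "i < dim_row (P * laplacian n F * P\<^sup>T)" "j < dim_col (P * laplacian n F * P\<^sup>T)"
    then have ij: "i < n" "j < n" by (auto simp: P_def)
    define Q where "Q = P * laplacian n F"
    have Q: "Q \<in> carrier_mat n n" using P L by (simp add: Q_def)
    have PL: "Q $$ (i, k) = laplacian n F $$ (g i, k)" if "k < n" for k
    proof -
      have "Q $$ (i, k) = (\<Sum>l = 0..<n. (if l = g i then 1 else 0) * laplacian n F $$ (l, k))"
        using ij that L by (auto simp: Q_def P_def scalar_prod_def intro!: sum.cong)
      then show ?thesis by (simp only: row[OF ij(1), of "\<lambda>l. laplacian n F $$ (l, k)"])
    qed
    have "(Q * P\<^sup>T) $$ (i, j) = (\<Sum>k = 0..<n. (if k = g j then 1 else 0) * laplacian n F $$ (g i, k))"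
      using ij Q by (auto simp: scalar_prod_def PL P_def intro!: sum.cong)
    also have "\<dots> = laplacian n F $$ (g i, g j)"
      by (rule row[OF ij(2)])
    also have "\<dots> = laplacian n E $$ (i, j)"
      using ij gn EF by (simp add: laplacian_def deg gi)
    finally show "laplacian n E $$ (i, j) = (P * laplacian n F * P\<^sup>T) $$ (i, j)" by (simp add: Q_def)
  qed (auto simp: laplacian_def P_def)
  then have "similar_mat (laplacian n E) (laplacian n F)"
    using similar_matI[of "laplacian n E" "laplacian n F" P "P\<^sup>T" n] PPT L P
      mat_mult_left_right_inverse[OF P _ PPT] by simp
  then show ?thesis unfolding lap_count_def by (simp add: char_poly_similar)
qed

section \<open>Lower bounds for the two extremal families\<close>

lemma sum_sum_subset_le_lap_form:
  assumes "K \<subseteq> {..<n}"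
  shows "(\<Sum>i\<in>K. \<Sum>j\<in>K. if E i j then (x i - x j)\<^sup>2 else 0) \<le> 2 * lap_form n E x"
proof -
  let ?g = "\<lambda>i j. if E i j then (x i - x j)\<^sup>2 else 0"
  have "(\<Sum>i\<in>K. \<Sum>j\<in>K. ?g i j) \<le> (\<Sum>i\<in>K. \<Sum>j<n. ?g i j)"
    using assms by (intro sum_mono sum_mono2) auto
  also have "\<dots> \<le> (\<Sum>i<n. \<Sum>j<n. ?g i j)"
    using assms by (intro sum_mono2 sum_nonneg) auto
  finally show ?thesis by (simp add: lap_form_def)
qed

lemma simple_graph_G_ndt: "t \<le> d \<Longrightarrow> simple_graph n (G_ndt n d t)"
  by (auto simp: simple_graph_def G_ndt_def)

lemma simple_graph_G_ndra: "simple_graph n (G_ndra n d r a)"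
  by (auto simp: simple_graph_def G_ndra_def)

text \<open>On the clique together with path vertex \<open>t - 1\<close> and its two path neighbours only one pair
  is not adjacent, so the form agrees with that of a complete graph as soon as \<open>x\<close> takes equal values at that pair.\<close>
lemma lap_count_G_ndt:
  assumes t: "2 \<le> t" "t \<le> d" and dn: "d + 2 \<le> n"
  shows "n - d \<le> lap_count n (G_ndt n d t) {real n - real d + 2..real n}"
proof -
  \<comment> \<open>There are \<open>d\<close> constraints, labelled by the path vertices other than
    \<open>t - 2\<close>: label \<open>t - 1\<close> makes the entries sum to \<open>0\<close>,
    label \<open>t\<close> equates the two outer values, and the others make \<open>x\<close> vanish
    off \<open>K\<close>.\<close>
  define \<phi> :: "nat \<Rightarrow> nat \<Rightarrow> real" where "\<phi> = (\<lambda>s i. if s = t - 1 then 1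
    else if s = t then (if i = t then 1 else 0) - (if i = t - 2 then 1 else 0)
    else (if i = s then 1 else 0))"
  have "n \<le> lap_count n (G_ndt n d t) {real n - real d + 2..real n} + card ({..d} - {t - 2})"
  proof (rule lap_count_ge[OF simple_graph_G_ndt[OF t(2)], where \<phi> = \<phi>])
    fix x assume x: "\<And>s. s \<in> {..d} - {t - 2} \<Longrightarrow> (\<Sum>i<n. \<phi> s i * x i) = 0"
    define K where "K = {d<..<n} \<union> {t - 2, t - 1, t}"
    have K: "K \<subseteq> {..<n}" using t dn by (auto simp: K_def)
    have "t - 1 \<in> {..d} - {t - 2}" using t by auto
    from x[OF this] have sum0: "(\<Sum>i<n. x i) = 0" by (simp add: \<phi>_def)
    have "(\<Sum>i<n. \<phi> t i * x i)
      = (\<Sum>i<n. (if i = t then 1 else 0) * x i) - (\<Sum>i<n. (if i = t - 2 then 1 else 0) * x i)"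
      unfolding sum_subtractf[symmetric] using t by (intro sum.cong) (auto simp: \<phi>_def left_diff_distrib)
    then have eq: "x t = x (t - 2)"
      using x[of t] t dn by (simp add: sum_indicator_mult)
    have off: "x i = 0" if "i < n" "i \<notin> K" for i
    proof -
      have i: "i \<le> d" "i \<noteq> t - 2" "i \<noteq> t - 1" "i \<noteq> t" using that by (auto simp: K_def)
      then have "(\<Sum>j<n. \<phi> i j * x j) = x i"
        using sum_indicator_mult[OF that(1), of x] by (simp add: \<phi>_def)
      then show ?thesis using x[of i] i by simp
    qed
    have sq: "(\<Sum>i<n. (x i)\<^sup>2) = (\<Sum>i\<in>K. (x i)\<^sup>2)" and s: "(\<Sum>i<n. x i) = (\<Sum>i\<in>K. x i)"
      using K off by (auto intro!: sum.mono_neutral_right)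
    have card: "real (card K) = real n - real d + 2"
    proof -
      have "t - 2 \<noteq> t - 1" "t - 2 \<noteq> t" "t - 1 \<noteq> t" using t by auto
      then have "card {t - 2, t - 1, t} = 3" by simp
      then have "card K = (n - Suc d) + 3"
        unfolding K_def using t by (subst card_Un_disjoint) auto
      then show ?thesis using dn by simp
    qed
    have "(\<Sum>i\<in>K. \<Sum>j\<in>K. (x i - x j)\<^sup>2) = (\<Sum>i\<in>K. \<Sum>j\<in>K. if G_ndt n d t i j then (x i - x j)\<^sup>2 else 0)"
      using t dn eq by (intro sum.cong) (auto simp: K_def G_ndt_def)
    also have "\<dots> \<le> 2 * lap_form n (G_ndt n d t) x" by (rule sum_sum_subset_le_lap_form[OF K])
    finally show "(real n - real d + 2) * (\<Sum>i<n. (x i)\<^sup>2) \<le> lap_form n (G_ndt n d t) x"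
      unfolding sum_sum_square_diff using sum0 by (simp add: sq s card)
  qed simp
  moreover have "card ({..d} - {t - 2}) = d" using t by (simp add: card_Diff_singleton)
  ultimately show ?thesis by simp
qed

text \<open>The clique together with path vertices \<open>r - 1\<close> and \<open>r\<close> is a clique of order \<open>n - d + 1\<close>, each
  of whose vertices has exactly one neighbour in \<open>{r - 2, r + 1}\<close>.\<close>
lemma lap_count_G_ndra:
  assumes r: "2 \<le> r" "r + 1 \<le> d" and dn: "d + 2 \<le> n"
  shows "n - d \<le> lap_count n (G_ndra n d r a) {real n - real d + 2..real n}"
proof -
  let ?G = "G_ndra n d r a"
  \<comment> \<open>Again \<open>d\<close> constraints: label \<open>r - 1\<close> makes the entries
    sum to \<open>0\<close>, and the others make \<open>x\<close> vanish on the path outside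
    \<open>{r - 1, r}\<close>.\<close>
  define \<phi> :: "nat \<Rightarrow> nat \<Rightarrow> real" where "\<phi> = (\<lambda>s i. if s = r - 1 then 1 else (if i = s then 1 else 0))"
  have "n \<le> lap_count n ?G {real n - real d + 2..real n} + card ({..d} - {r})"
  proof (rule lap_count_ge[OF simple_graph_G_ndra, where \<phi> = \<phi>])
    fix x assume x: "\<And>s. s \<in> {..d} - {r} \<Longrightarrow> (\<Sum>i<n. \<phi> s i * x i) = 0"
    define K where "K = {d<..<n} \<union> {r - 1, r}"
    define M where "M = {r - 2, Suc r}"
    have K: "K \<subseteq> {..<n}" "finite K" using r dn by (auto simp: K_def)
    have M: "M \<subseteq> {..<n}" "K \<inter> M = {}" "finite M" using r dn by (auto simp: K_def M_def)
    have "r - 1 \<in> {..d} - {r}" using r by auto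
    from x[OF this] have sum0: "(\<Sum>i<n. x i) = 0" by (simp add: \<phi>_def)
    have off: "x i = 0" if "i < n" "i \<notin> K" for i
    proof -
      have i: "i \<le> d" "i \<noteq> r - 1" "i \<noteq> r" using that by (auto simp: K_def)
      then have "(\<Sum>j<n. \<phi> i j * x j) = x i"
        using sum_indicator_mult[OF that(1), of x] by (simp add: \<phi>_def)
      then show ?thesis using x[of i] i by simp
    qed
    have sq: "(\<Sum>i<n. (x i)\<^sup>2) = (\<Sum>i\<in>K. (x i)\<^sup>2)" and s: "(\<Sum>i<n. x i) = (\<Sum>i\<in>K. x i)"
      using K off by (auto intro!: sum.mono_neutral_right)
    have card: "real (card K) = real n - real d + 1"
    proof -
      have "card {r - 1, r} = 2" using r by auto
      then have "card K = (n - Suc d) + 2"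
        unfolding K_def using r by (subst card_Un_disjoint) auto
      then show ?thesis using dn by simp
    qed
    let ?g = "\<lambda>i j. if ?G i j then (x i - x j)\<^sup>2 else 0"
    have xM: "x (r - 2) = 0" "x (Suc r) = 0"
      using off[of "r - 2"] off[of "Suc r"] M by (auto simp: M_def)
    \<comment> \<open>This removes the truncated subtractions \<open>r - 1\<close> and
      \<open>r - 2\<close> from the adjacency computations.\<close>
    obtain k where k: "r = Suc (Suc k)" using r by (metis add_2_eq_Suc less_eqE)
    have Kj: "j = Suc k \<or> j = Suc (Suc k) \<or> d < j \<and> j < n" if "j \<in> K" for j
      using that by (auto simp: K_def k)
    have GM: "?G (r - 2) j \<longleftrightarrow> j = r - 1 \<or> d < j \<and> j \<le> d + a"
      "?G (Suc r) j \<longleftrightarrow> j = r \<or> d + a < j" if "j \<in> K" for j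
      using Kj[OF that] r dn by (elim disjE; simp add: k G_ndra_def cross_ndra_def; linarith)+
    have GK: "?G i j \<longleftrightarrow> i \<noteq> j" if "i \<in> K" "j \<in> K" for i j
      using Kj[OF that(1)] Kj[OF that(2)] r dn
      by (elim disjE; simp add: k G_ndra_def cross_ndra_def; linarith)
    have "r - 2 \<noteq> Suc r" by simp
    then have "(\<Sum>j\<in>K. ?g (r - 2) j + ?g (Suc r) j) = (\<Sum>i\<in>M. \<Sum>j\<in>K. ?g i j)"
      by (simp add: M_def sum.distrib)
    \<comment> \<open>The single neighbour of \<open>j\<close> in \<open>M\<close> has value
      \<open>0\<close>, so \<open>j\<close> contributes its own square once. This raises the
      clique's factor \<open>card K\<close>, that is \<open>n - d + 1\<close>, to
      \<open>n - d + 2\<close>.\<close>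
    moreover have "(\<Sum>j\<in>K. ?g (r - 2) j + ?g (Suc r) j) = (\<Sum>j\<in>K. (x j)\<^sup>2)"
    proof (rule sum.cong[OF refl])
      fix j assume j: "j \<in> K"
      then have "j = r - 1 \<or> j = r \<or> d < j" by (auto simp: K_def)
      then show "?g (r - 2) j + ?g (Suc r) j = (x j)\<^sup>2"
        unfolding GM[OF j] using r by (auto simp: xM)
    qed
    moreover have "(\<Sum>i\<in>K. \<Sum>j\<in>K. ?g i j) = (\<Sum>i\<in>K. \<Sum>j\<in>K. (x i - x j)\<^sup>2)"
      by (intro sum.cong) (auto simp: GK)
    moreover have "(\<Sum>i\<in>K \<union> M \<union> {}. \<Sum>j\<in>K \<union> M \<union> {}. ?g i j) = (\<Sum>i\<in>K. \<Sum>j\<in>K. ?g i j) + (\<Sum>i\<in>M. \<Sum>j\<in>M. ?g i j)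
        + (\<Sum>i\<in>{}. \<Sum>j\<in>{}. ?g i j) + 2 * (\<Sum>i\<in>M. \<Sum>j\<in>K. ?g i j)
        + 2 * (\<Sum>i\<in>{}. \<Sum>j\<in>K. ?g i j) + 2 * (\<Sum>i\<in>{}. \<Sum>j\<in>M. ?g i j)"
      using K M by (intro sum_sum_symmetric_Un3) (auto simp: power2_commute G_ndra_def)
    moreover have "(\<Sum>i\<in>K \<union> M. \<Sum>j\<in>K \<union> M. ?g i j) \<le> 2 * lap_form n ?G x"
      using K M by (intro sum_sum_subset_le_lap_form) auto
    moreover have "0 \<le> (\<Sum>i\<in>M. \<Sum>j\<in>M. ?g i j)" by (intro sum_nonneg) auto
    ultimately have "(\<Sum>i\<in>K. \<Sum>j\<in>K. (x i - x j)\<^sup>2) + 2 * (\<Sum>j\<in>K. (x j)\<^sup>2) \<le> 2 * lap_form n ?G x"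
      by simp
    then show "(real n - real d + 2) * (\<Sum>i<n. (x i)\<^sup>2) \<le> lap_form n ?G x"
      unfolding sum_sum_square_diff using sum0 by (simp add: sq s card algebra_simps)
  qed simp
  moreover have "card ({..d} - {r}) = d" using r by (simp add: card_Diff_singleton)
  ultimately show ?thesis by simp
qed

section \<open>Geodesics and classification\<close>

lemma walk_len_append: "walk_len E k i j \<Longrightarrow> walk_len E l j m \<Longrightarrow> walk_len E (k + l) i m"
  by (induction rule: walk_len.induct) (auto intro: walk_len.intros)

lemma walk_len_vertices:
  "walk_len E k i j \<Longrightarrow> \<exists>f. f 0 = i \<and> f k = j \<and> (\<forall>m<k. E (f m) (f (Suc m)))"
proof (induction rule: walk_len.induct)
  case (walk_cons i j k l)
  then obtain f where f: "f 0 = j" "f k = l" "\<forall>m<k. E (f m) (f (Suc m))" by blast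
  have "\<forall>m<Suc k. E (case_nat i f m) (case_nat i f (Suc m))"
    using f walk_cons(1) by (auto simp: less_Suc_eq_0_disj)
  then show ?case using f by (intro exI[of _ "case_nat i f"]) auto
qed (auto intro: exI[of _ "\<lambda>_. _"])

lemma walk_len_segment:
  assumes "\<And>m. m < d \<Longrightarrow> E (f m) (f (Suc m))" and "a + k \<le> d"
  shows "walk_len E k (f a) (f (a + k))"
  using assms(2)
proof (induction k arbitrary: a)
  case (Suc k)
  then show ?case using Suc.IH[of "Suc a"] assms(1)[of a] by (auto intro: walk_len.intros)
qed (auto intro: walk_len.intros)

text \<open>A shortest walk between two vertices at distance \<open>d\<close>. A walk from
  \<open>f a\<close> to \<open>f b\<close> of length less than \<open>b - a\<close> would shorten
  the whole walk below that distance.\<close>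

lemma diametral_geodesic:
  assumes n: "0 < n" and conn: "connected_graph n E" and diam: "diameter n E = d"
  obtains f where "\<And>m. m < d \<Longrightarrow> E (f m) (f (Suc m))"
    "\<And>a b k. a \<le> d \<Longrightarrow> b \<le> d \<Longrightarrow> walk_len E k (f a) (f b) \<Longrightarrow> b \<le> a + k"
proof -
  let ?D = "{graph_dist E i j | i j. i < n \<and> j < n}"
  have "?D = (\<lambda>(i, j). graph_dist E i j) ` ({..<n} \<times> {..<n})" by auto
  then have "finite ?D" by simp
  moreover have "?D \<noteq> {}" using n by auto
  ultimately have "d \<in> ?D" using Max_in[of ?D] diam by (simp add: diameter_def)
  then obtain i j where ij: "i < n" "j < n" "graph_dist E i j = d" by auto
  have "walk_len E d i j"
    using conn ij LeastI_ex[of "\<lambda>k. walk_len E k i j"] by (auto simp: connected_graph_def graph_dist_def)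
  then obtain f where f: "f 0 = i" "f d = j" "\<forall>m<d. E (f m) (f (Suc m))"
    using walk_len_vertices by blast
  have E: "E (f m) (f (Suc m))" if "m < d" for m using f that by blast
  have "b \<le> a + k" if ab: "a \<le> d" "b \<le> d" and wk: "walk_len E k (f a) (f b)" for a b k
  proof -
    have "walk_len E a i (f a)" using walk_len_segment[of d E f 0 a, OF E] ab f by simp
    moreover have "walk_len E (d - b) (f b) j"
      using walk_len_segment[of d E f b "d - b", OF E] ab f by simp
    ultimately have "walk_len E (a + k + (d - b)) i j" using wk by (blast intro: walk_len_append)
    then have "d \<le> a + k + (d - b)" unfolding ij(3)[symmetric] graph_dist_def by (rule Least_le)
    then show ?thesis using ab by simp
  qed
  then show thesis using that E by blast
qed

text \<open>A geodesic is injective and induced, so some bijection carries it to \<open>0..d\<close>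
  and the other vertices to the numbers above \<open>d\<close>.\<close>

lemma geodesic_relabelling:
  assumes n: "0 < n" and simple: "simple_graph n E" and conn: "connected_graph n E"
    and diam: "diameter n E = d" and d: "2 \<le> d"
    and not_path: "\<not> graph_iso n E (d + 1) (path_graph (d + 1))"
  obtains F where "graph_iso n E n F" "geodesic_labelling n d F"
proof -
  obtain f where f: "\<And>m. m < d \<Longrightarrow> E (f m) (f (Suc m))" and
    geo: "\<And>a b k. a \<le> d \<Longrightarrow> b \<le> d \<Longrightarrow> walk_len E k (f a) (f b) \<Longrightarrow> b \<le> a + k"
    by (rule diametral_geodesic[OF n conn diam]) blast
  have sym: "E i j \<Longrightarrow> E j i" and irrefl: "\<not> E i i" and bnd: "E i j \<Longrightarrow> i < n \<and> j < n" for i j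
    using simple by (auto simp: simple_graph_def)
  have fn: "f m < n" if "m \<le> d" for m
    using bnd[OF f[of m]] bnd[OF f[of "m - 1"]] that d by (cases "m < d") auto
  have inj: "inj_on f {..d}"
  proof (rule inj_onI)
    fix a b assume "a \<in> {..d}" "b \<in> {..d}" "f a = f b"
    then have "b \<le> a + 0" "a \<le> b + 0"
      using geo[of a b 0] geo[of b a 0] walk_nil[of E] by auto
    then show "a = b" by simp
  qed
  have sub: "f ` {..d} \<subseteq> {0..<n}" using fn by auto
  have dn: "d + 1 \<le> n" using card_mono[OF _ sub] card_image[OF inj] by simp
  have "card ({0..<n} - f ` {..d}) = card {d<..<n}"
    using sub inj by (simp add: card_Diff_subset card_image)
  then obtain k where k: "bij_betw k {d<..<n} ({0..<n} - f ` {..d})"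
    using finite_same_card_bij[of "{d<..<n}" "{0..<n} - f ` {..d}"] by auto
  define h where "h i = (if i \<le> d then f i else k i)" for i
  have "bij_betw h {..d} (f ` {..d})"
    using inj by (auto simp: h_def bij_betw_def inj_on_def)
  moreover have "bij_betw h {d<..<n} ({0..<n} - f ` {..d})"
    using k by (subst bij_betw_cong[of _ _ k]) (auto simp: h_def)
  ultimately have "bij_betw h ({..d} \<union> {d<..<n}) (f ` {..d} \<union> ({0..<n} - f ` {..d}))"
    by (rule bij_betw_combine) auto
  moreover have "{..d} \<union> {d<..<n} = {0..<n}" using dn by auto
  moreover have "f ` {..d} \<union> ({0..<n} - f ` {..d}) = {0..<n}" using sub by auto
  ultimately have h: "bij_betw h {0..<n} {0..<n}" by simp
  define F where "F i j \<longleftrightarrow> i < n \<and> j < n \<and> E (h i) (h j)" for i j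
  have "graph_iso n F n E" unfolding graph_iso_def using h by (auto simp: F_def)
  then have iso: "graph_iso n E n F" by (rule graph_iso_sym)
  have step: "walk_len E 1 i j" if "E i j" for i j using that by (auto intro: walk_len.intros)
  have path: "F i j \<longleftrightarrow> i + 1 = j \<or> j + 1 = i" if ij: "i \<le> d" "j \<le> d" for i j
  proof
    assume "F i j"
    then have e: "E (f i) (f j)" using ij by (simp add: F_def h_def)
    then have "j \<le> i + 1" "i \<le> j + 1" "i \<noteq> j"
      using geo[OF ij step[OF e]] geo[OF ij(2,1) step[OF sym[OF e]]] e irrefl by auto
    then show "i + 1 = j \<or> j + 1 = i" by auto
  next
    assume "i + 1 = j \<or> j + 1 = i"
    then show "F i j" using f[of i] f[of j] sym ij dn by (auto simp: F_def h_def)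
  qed
  \<comment> \<open>Without a vertex off the geodesic the whole graph would be the excluded
    path.\<close>
  have "n \<noteq> d + 1"
  proof
    assume "n = d + 1"
    then have "\<forall>i<n. \<forall>j<n. F i j \<longleftrightarrow> path_graph (d + 1) i j"
      using path by (auto simp: path_graph_def)
    then have "graph_iso n F (d + 1) (path_graph (d + 1))"
      unfolding graph_iso_def using \<open>n = d + 1\<close> by (intro exI[of _ id]) auto
    then show False using not_path graph_iso_trans[OF iso] by blast
  qed
  moreover have "simple_graph n F" using sym irrefl by (auto simp: simple_graph_def F_def)
  \<comment> \<open>Two path neighbours of \<open>w\<close> are joined by a walk of length 2 through
    \<open>w\<close>.\<close>
  moreover have "j \<le> i + 2" if "i \<le> d" "j \<le> d" "F w i" "F w j" for w i j
  proof -
    have "E (f i) (h w)" "E (h w) (f j)" using that sym by (auto simp: F_def h_def)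
    then have "walk_len E 2 (f i) (f j)"
      by (metis step walk_len_append one_add_one)
    then show ?thesis using geo that by blast
  qed
  ultimately have "geodesic_labelling n d F"
    using d dn path by unfold_locales auto
  then show thesis using that iso by blast
qed

text \<open>Common description of \<open>G_ndt\<close> and \<open>G_ndra\<close>: \<open>c w\<close> is the index of the middle one of the three
  path neighbours of the clique vertex \<open>w\<close>.\<close>
definition clique_on_path :: "nat \<Rightarrow> nat \<Rightarrow> (nat \<Rightarrow> nat \<Rightarrow> bool) \<Rightarrow> (nat \<Rightarrow> nat) \<Rightarrow> bool" where
  "clique_on_path n d E c \<longleftrightarrow> simple_graph n E
    \<and> (\<forall>i\<le>d. \<forall>j\<le>d. E i j \<longleftrightarrow> i + 1 = j \<or> j + 1 = i)
    \<and> (\<forall>u\<in>{d<..<n}. \<forall>w\<in>{d<..<n}. u \<noteq> w \<longrightarrow> E u w)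
    \<and> (\<forall>w\<in>{d<..<n}. 1 \<le> c w \<and> c w < d \<and> (\<forall>i\<le>d. E w i \<longleftrightarrow> i \<in> {c w - 1, c w, c w + 1}))"

lemma clique_on_pathD:
  assumes "clique_on_path n d E c"
  shows "simple_graph n E"
    and "\<And>i j. i \<le> d \<Longrightarrow> j \<le> d \<Longrightarrow> E i j \<longleftrightarrow> i + 1 = j \<or> j + 1 = i"
    and "\<And>u w. u \<in> {d<..<n} \<Longrightarrow> w \<in> {d<..<n} \<Longrightarrow> u \<noteq> w \<Longrightarrow> E u w"
    and "\<And>w. w \<in> {d<..<n} \<Longrightarrow> 1 \<le> c w" and "\<And>w. w \<in> {d<..<n} \<Longrightarrow> c w < d"
    and "\<And>w i. w \<in> {d<..<n} \<Longrightarrow> i \<le> d \<Longrightarrow> E w i \<longleftrightarrow> i \<in> {c w - 1, c w, c w + 1}"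
  using assms unfolding clique_on_path_def by blast+

lemma clique_on_path_G_ndt:
  assumes "2 \<le> t" "t \<le> d" "d < n"
  shows "clique_on_path n d (G_ndt n d t) (\<lambda>_. t - 1)"
  using assms simple_graph_G_ndt[of t d n]
  by (auto simp: clique_on_path_def G_ndt_def)

lemma clique_on_path_G_ndra:
  assumes "2 \<le> r" "r + 1 \<le> d" "d < n"
  shows "clique_on_path n d (G_ndra n d r a) (\<lambda>w. if w \<le> d + a then r - 1 else r)"
  using assms simple_graph_G_ndra[of n d r a]
  by (auto simp: clique_on_path_def G_ndra_def cross_ndra_def)

text \<open>Such a graph is determined by how its centres are distributed over the clique: a
  permutation matching the centres, extended by the identity on the path, is an isomorphism.\<close>

lemma clique_on_path_iso:
  assumes E: "clique_on_path n d E c" and F: "clique_on_path n d F c'" and dn: "d < n"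
    and \<sigma>: "bij_betw \<sigma> {d<..<n} {d<..<n}" "\<And>w. w \<in> {d<..<n} \<Longrightarrow> c' (\<sigma> w) = c w"
  shows "graph_iso n E n F"
proof -
  define h where "h i = (if i \<le> d then i else \<sigma> i)" for i
  have "bij_betw h {..d} {..d}" by (auto simp: h_def bij_betw_def inj_on_def)
  moreover have "bij_betw h {d<..<n} {d<..<n}"
    using \<sigma>(1) by (subst bij_betw_cong[of _ _ \<sigma>]) (auto simp: h_def)
  ultimately have "bij_betw h ({..d} \<union> {d<..<n}) ({..d} \<union> {d<..<n})"
    by (rule bij_betw_combine) auto
  moreover have "{..d} \<union> {d<..<n} = {0..<n}" using dn by auto
  ultimately have h: "bij_betw h {0..<n} {0..<n}" by simp
  have \<sigma>_in: "\<sigma> w \<in> {d<..<n}" if "w \<in> {d<..<n}" for w using \<sigma>(1) that by (rule bij_betw_apply)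
  note DE = clique_on_pathD[OF E] and DF = clique_on_pathD[OF F]
  have sE: "E i j \<longleftrightarrow> E j i" "\<not> E i i" and sF: "F i j \<longleftrightarrow> F j i" "\<not> F i i" for i j
    using DE(1) DF(1) by (auto simp: simple_graph_def)
  have pp: "E i j \<longleftrightarrow> F i j" if "i \<le> d" "j \<le> d" for i j
    using DE(2)[OF that] DF(2)[OF that] by blast
  have qp: "E w i \<longleftrightarrow> F (\<sigma> w) i" if "w \<in> {d<..<n}" "i \<le> d" for w i
    using DE(6)[OF that] DF(6)[OF \<sigma>_in[OF that(1)] that(2)] unfolding \<sigma>(2)[OF that(1)] by blast
  have qq: "E u w \<longleftrightarrow> F (\<sigma> u) (\<sigma> w)" if "u \<in> {d<..<n}" "w \<in> {d<..<n}" for u w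
  proof (cases "u = w")
    case False
    then have "\<sigma> u \<noteq> \<sigma> w" using \<sigma>(1) that by (auto simp: bij_betw_def inj_on_def)
    then have "E u w" "F (\<sigma> u) (\<sigma> w)"
      using DE(3)[OF that False] DF(3)[OF \<sigma>_in[OF that(1)] \<sigma>_in[OF that(2)]] by blast+
    then show ?thesis by blast
  qed (simp add: sE sF)
  have "E i j \<longleftrightarrow> F (h i) (h j)" if ij: "i < n" "j < n" for i j
  proof (cases "i \<le> d"; cases "j \<le> d")
    assume "i \<le> d" "\<not> j \<le> d"
    then show ?thesis using qp[of j i] ij sE(1)[of i j] sF(1)[of i "\<sigma> j"] by (simp add: h_def)
  qed (use pp qp qq ij in \<open>auto simp: h_def\<close>)
  then show ?thesis unfolding graph_iso_def using h by blast
qed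

text \<open>Reversing the path sends centre \<open>c w\<close> to \<open>d - c w\<close>. This
  symmetry is why \<open>t\<close> and \<open>r\<close> can be kept in the lower half of their
  ranges.\<close>

lemma clique_on_path_reverse:
  assumes E: "clique_on_path n d E c" and dn: "d < n"
  obtains F where "graph_iso n E n F" "clique_on_path n d F (\<lambda>w. d - c w)"
proof -
  note DE = clique_on_pathD[OF E]
  define \<rho> where "\<rho> i = (if i \<le> d then d - i else i)" for i
  have "\<rho> (\<rho> i) = i" for i by (auto simp: \<rho>_def)
  moreover have \<rho>n: "\<rho> i < n \<longleftrightarrow> i < n" for i using dn by (auto simp: \<rho>_def)
  ultimately have \<rho>: "bij_betw \<rho> {0..<n} {0..<n}" by (intro bij_betw_byWitness[of _ \<rho>]) auto
  define F where "F i j \<longleftrightarrow> E (\<rho> i) (\<rho> j)" for i j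
  have "graph_iso n F n E" unfolding graph_iso_def using \<rho> by (auto simp: F_def)
  then have "graph_iso n E n F" by (rule graph_iso_sym)
  moreover have "clique_on_path n d F (\<lambda>w. d - c w)"
    unfolding clique_on_path_def
  proof (intro conjI ballI allI impI)
    show "simple_graph n F" using DE(1) \<rho>n unfolding simple_graph_def F_def by blast
    show "F i j \<longleftrightarrow> i + 1 = j \<or> j + 1 = i" if "i \<le> d" "j \<le> d" for i j
      using DE(2)[of "d - i" "d - j"] that by (auto simp: F_def \<rho>_def)
    show "F u w" if "u \<in> {d<..<n}" "w \<in> {d<..<n}" "u \<noteq> w" for u w
      using DE(3)[OF that] that by (simp add: F_def \<rho>_def)
    fix w assume w: "w \<in> {d<..<n}"
    note c = DE(4-6)[OF w]
    then show "1 \<le> d - c w" "d - c w < d" by auto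
    show "F w i \<longleftrightarrow> i \<in> {d - c w - 1, d - c w, d - c w + 1}" if "i \<le> d" for i
    proof -
      have "F w i \<longleftrightarrow> d - i \<in> {c w - 1, c w, c w + 1}"
        using c(3)[of "d - i"] w that by (simp add: F_def \<rho>_def)
      also have "\<dots> \<longleftrightarrow> i \<in> {d - c w - 1, d - c w, d - c w + 1}"
        using c(1,2) that unfolding insert_iff empty_iff by linarith
      finally show ?thesis .
    qed
  qed
  ultimately show thesis by (rule that)
qed

section \<open>Reduction of the possible centres to the two families\<close>

lemma clique_on_path_single_centre:
  assumes E: "clique_on_path n d E c" and dn: "d + 2 \<le> n"
    and s: "\<And>w. w \<in> {d<..<n} \<Longrightarrow> c w = s"
  shows "\<exists>t. 2 \<le> t \<and> t \<le> d div 2 + 1 \<and> graph_iso n E n (G_ndt n d t)"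
proof -
  have s1: "1 \<le> s" "s < d" using clique_on_pathD(4,5)[OF E, of "d + 1"] s[of "d + 1"] dn by auto
  \<comment> \<open>Centres are counted from \<open>0\<close> but \<open>t\<close> from
    \<open>1\<close>, hence the shift by one.\<close>
  have iso: "graph_iso n F n (G_ndt n d (k + 1))"
    if "clique_on_path n d F c'" "\<And>w. w \<in> {d<..<n} \<Longrightarrow> c' w = k" "1 \<le> k" "k < d" for F c' k
    using clique_on_path_iso[OF that(1) clique_on_path_G_ndt[of "k + 1" d n], of id] that dn by simp
  show ?thesis
  proof (cases "s \<le> d div 2")
    case True
    then show ?thesis using iso[OF E s] s1 by (intro exI[of _ "s + 1"]) auto
  next
    case False
    obtain F where F: "graph_iso n E n F" "clique_on_path n d F (\<lambda>w. d - c w)"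
      using clique_on_path_reverse[OF E] dn by auto
    have "graph_iso n F n (G_ndt n d (d - s + 1))"
      using iso[OF F(2), of "d - s"] s s1 by simp
    then have "graph_iso n E n (G_ndt n d (d - s + 1))" by (rule graph_iso_trans[OF F(1)])
    then show ?thesis using False s1 by (intro exI[of _ "d - s + 1"]) auto
  qed
qed

text \<open>Here \<open>a\<close> is the number of clique vertices with the lower centre
  \<open>s\<close>. A permutation moves them to \<open>d + 1..d + a\<close>, where
  \<open>G_ndra\<close> with \<open>r = s + 1\<close> has its vertices of lower centre.\<close>

lemma clique_on_path_two_centres_iso:
  assumes E: "clique_on_path n d E c" and dn: "d + 2 \<le> n"
    and c: "\<And>w. w \<in> {d<..<n} \<Longrightarrow> c w = s \<or> c w = s + 1"
    and u: "u \<in> {d<..<n}" "c u = s" and v: "v \<in> {d<..<n}" "c v = s + 1"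
  shows "\<exists>a. 1 \<le> a \<and> a \<le> n - d - 2 \<and> graph_iso n E n (G_ndra n d (s + 1) a)"
proof -
  define A where "A = {w \<in> {d<..<n}. c w = s}"
  define B where "B = {w \<in> {d<..<n}. c w = s + 1}"
  define a where "a = card A"
  have AB: "A \<union> B = {d<..<n}" "A \<inter> B = {}" "finite A" "finite B"
    using c unfolding A_def B_def by (blast, auto)
  have "card A + card B = n - d - 1"
    using card_Un_disjoint[OF AB(3,4,2)] AB(1) by simp
  moreover have "0 < card A" "0 < card B" using AB u v by (auto simp: card_gt_0_iff A_def B_def)
  ultimately have a: "1 \<le> a" "a \<le> n - d - 2" "card B = n - d - 1 - a" by (auto simp: a_def)
  have "card A = card {d<..d + a}" "card B = card {d + a<..<n}" using a(3) by (simp_all add: a_def)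
  then obtain f g where f: "bij_betw f A {d<..d + a}" and g: "bij_betw g B {d + a<..<n}"
    using finite_same_card_bij AB(3,4) finite_greaterThanAtMost finite_greaterThanLessThan by meson
  define \<sigma> where "\<sigma> w = (if w \<in> A then f w else g w)" for w
  have "bij_betw \<sigma> A {d<..d + a}" using f by (subst bij_betw_cong[of _ _ f]) (auto simp: \<sigma>_def)
  moreover have "bij_betw \<sigma> B {d + a<..<n}"
    using g AB(2) by (subst bij_betw_cong[of _ _ g]) (auto simp: \<sigma>_def)
  ultimately have "bij_betw \<sigma> (A \<union> B) ({d<..d + a} \<union> {d + a<..<n})"
    by (rule bij_betw_combine) auto
  moreover have "{d<..d + a} \<union> {d + a<..<n} = {d<..<n}" using a dn by auto
  ultimately have \<sigma>: "bij_betw \<sigma> {d<..<n} {d<..<n}" using AB(1) by simp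
  have s: "1 \<le> s" "s + 1 < d"
    using clique_on_pathD(4)[OF E u(1)] clique_on_pathD(5)[OF E v(1)] u v by auto
  have "graph_iso n E n (G_ndra n d (s + 1) a)"
  proof (rule clique_on_path_iso[OF E clique_on_path_G_ndra _ \<sigma>])
    fix w assume w: "w \<in> {d<..<n}"
    show "(if \<sigma> w \<le> d + a then s + 1 - 1 else s + 1) = c w"
    proof (cases "w \<in> A")
      case True
      then show ?thesis using bij_betw_apply[OF f True] by (auto simp: \<sigma>_def A_def)
    next
      case False
      then have "w \<in> B" using w AB(1) by blast
      then show ?thesis using bij_betw_apply[OF g, of w] False by (auto simp: \<sigma>_def B_def)
    qed
  qed (use s dn in auto)
  then show ?thesis using a by blast
qed

lemma clique_on_path_two_centres:
  assumes E: "clique_on_path n d E c" and dn: "d + 2 \<le> n"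
    and c: "\<And>w. w \<in> {d<..<n} \<Longrightarrow> c w = s \<or> c w = s + 1"
    and u: "u \<in> {d<..<n}" "c u = s" and v: "v \<in> {d<..<n}" "c v = s + 1"
  shows "\<exists>r a. 2 \<le> r \<and> r \<le> (d + 1) div 2 \<and> 1 \<le> a \<and> a \<le> n - d - 2 \<and> graph_iso n E n (G_ndra n d r a)"
proof -
  have s: "1 \<le> s" "s + 1 < d"
    using clique_on_pathD(4)[OF E u(1)] clique_on_pathD(5)[OF E v(1)] u v by auto
  show ?thesis
  proof (cases "s + 1 \<le> (d + 1) div 2")
    case True
    obtain a where "1 \<le> a" "a \<le> n - d - 2" "graph_iso n E n (G_ndra n d (s + 1) a)"
      using clique_on_path_two_centres_iso[OF E dn c u v] by blast
    then show ?thesis using True s by (intro exI[of _ "s + 1"] exI[of _ a]) auto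
  next
    case False
    obtain F where F: "graph_iso n E n F" "clique_on_path n d F (\<lambda>w. d - c w)"
      using clique_on_path_reverse[OF E] dn by auto
    have c': "d - c w = d - s - 1 \<or> d - c w = d - s - 1 + 1" if "w \<in> {d<..<n}" for w
      using c[OF that] s by auto
    \<comment> \<open>Reversal also reverses the order of the centres, so \<open>v\<close> now has
      the lower one and \<open>u\<close> the upper one.\<close>
    have "d - c v = d - s - 1" "d - c u = d - s - 1 + 1" using u v s by auto
    from clique_on_path_two_centres_iso[OF F(2) dn c' v(1) this(1) u(1) this(2)]
    obtain a where a: "1 \<le> a" "a \<le> n - d - 2" "graph_iso n F n (G_ndra n d (d - s - 1 + 1) a)"
      by blast
    from graph_iso_trans[OF F(1) a(3)] a(1,2) show ?thesis
      using False s by (intro exI[of _ "d - s - 1 + 1"] exI[of _ a]) auto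
  qed
qed

lemma (in geodesic_labelling) equality_imp_extremal:
  assumes eq: "lap_count n E {real n - real d + 2..real n} = n - d"
  shows "(\<exists>t. 2 \<le> t \<and> t \<le> d div 2 + 1 \<and> graph_iso n E n (G_ndt n d t))
    \<or> (\<exists>r a. 2 \<le> r \<and> r \<le> (d + 1) div 2 \<and> 1 \<le> a \<and> a \<le> n - d - 2 \<and> graph_iso n E n (G_ndra n d r a))"
proof -
  have "\<exists>t. 1 \<le> t \<and> t < d \<and> (\<forall>i\<le>d. E w i \<longleftrightarrow> i \<in> {t - 1, t, t + 1})
      \<and> (\<forall>u\<in>{d<..<n} - {w}. E u w \<and> E u t)" if "w \<in> {d<..<n}" for w
  proof -
    have "d < w" "w < n" using that by auto
    then obtain t where "1 \<le> t" "t < d" "\<And>i. i \<le> d \<Longrightarrow> E w i \<longleftrightarrow> i \<in> {t - 1, t, t + 1}"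
      "\<And>u. d < u \<Longrightarrow> u < n \<Longrightarrow> u \<noteq> w \<Longrightarrow> E u w \<and> E u t"
      by (rule equality_structure[OF eq]) blast
    then show ?thesis by (intro exI[of _ t]) simp
  qed
  then have "\<forall>w\<in>{d<..<n}. \<exists>t. 1 \<le> t \<and> t < d \<and> (\<forall>i\<le>d. E w i \<longleftrightarrow> i \<in> {t - 1, t, t + 1})
      \<and> (\<forall>u\<in>{d<..<n} - {w}. E u w \<and> E u t)" by blast
  from bchoice[OF this] obtain c where c: "\<And>w. w \<in> {d<..<n} \<Longrightarrow> 1 \<le> c w \<and> c w < d
      \<and> (\<forall>i\<le>d. E w i \<longleftrightarrow> i \<in> {c w - 1, c w, c w + 1}) \<and> (\<forall>u\<in>{d<..<n} - {w}. E u w \<and> E u (c w))"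
    by blast
  have cop: "clique_on_path n d E c"
    unfolding clique_on_path_def
  proof (intro conjI ballI allI impI)
    show "E u w" if "u \<in> {d<..<n}" "w \<in> {d<..<n}" "u \<noteq> w" for u w using c[OF that(2)] that by blast
  qed (use simple path c in blast)+
  \<comment> \<open>\<open>u\<close> is adjacent to \<open>c w\<close>, which therefore lies in the
    triple around \<open>c u\<close>. Hence the centres differ by at most one, and with
    \<open>s\<close> the smallest, only \<open>s\<close> and \<open>s + 1\<close> occur.\<close>
  have near: "c w \<le> c u + 1" if "u \<in> {d<..<n}" "w \<in> {d<..<n}" for u w
  proof (cases "u = w")
    case False
    then have "E u (c w)" "c w \<le> d" using c[OF that(2)] that by auto
    then show ?thesis using c[OF that(1)] by auto
  qed simp
  define s where "s = Min (c ` {d<..<n})"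
  have "d + 1 \<in> {d<..<n}" using dn by simp
  then have "s \<in> c ` {d<..<n}" unfolding s_def by (intro Min_in) auto
  then obtain u where u: "u \<in> {d<..<n}" "c u = s" by auto
  have cs: "c w = s \<or> c w = s + 1" if "w \<in> {d<..<n}" for w
  proof -
    have "s \<le> c w" unfolding s_def using that by (intro Min_le) auto
    then show ?thesis using near[OF u(1) that] u(2) by auto
  qed
  show ?thesis
  proof (cases "\<exists>v\<in>{d<..<n}. c v = s + 1")
    case True
    then obtain v where "v \<in> {d<..<n}" "c v = s + 1" by blast
    from clique_on_path_two_centres[OF cop dn cs u this] show ?thesis by blast
  next
    case False
    then have "\<And>w. w \<in> {d<..<n} \<Longrightarrow> c w = s" using cs by blast
    from clique_on_path_single_centre[OF cop dn this] show ?thesis by blast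
  qed
qed

theorem theorem1p2:
  fixes n d :: nat and E :: "nat \<Rightarrow> nat \<Rightarrow> bool"
  assumes "0 < n" and "simple_graph n E"
    and "connected_graph n E"
    and "diameter n E = d"
    and "d \<ge> 2"
    and "\<not> graph_iso n E (d + 1) (path_graph (d + 1))"
  shows "lap_count n E {real n - real d + 2 .. real n} \<le> n - d
    \<and> (lap_count n E {real n - real d + 2 .. real n} = n - d \<longleftrightarrow>
         (\<exists>t. 2 \<le> t \<and> t \<le> d div 2 + 1 \<and> graph_iso n E n (G_ndt n d t))
       \<or> (\<exists>r a. 2 \<le> r \<and> r \<le> (d + 1) div 2 \<and> 1 \<le> a \<and> a \<le> n - d - 2
              \<and> graph_iso n E n (G_ndra n d r a)))"
proof -
  let ?I = "{real n - real d + 2 .. real n}"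
  obtain F where iso: "graph_iso n E n F" and "geodesic_labelling n d F"
    using geodesic_relabelling[OF assms] by blast
  then interpret F: geodesic_labelling n d F by simp
  have le: "lap_count n E ?I \<le> n - d"
    using F.lap_count_le lap_count_graph_iso[OF iso] by simp
  show ?thesis
  proof (intro conjI iffI)
    assume "lap_count n E ?I = n - d"
    then have "lap_count n F ?I = n - d" using lap_count_graph_iso[OF iso] by simp
    from F.equality_imp_extremal[OF this]
    show "(\<exists>t. 2 \<le> t \<and> t \<le> d div 2 + 1 \<and> graph_iso n E n (G_ndt n d t))
       \<or> (\<exists>r a. 2 \<le> r \<and> r \<le> (d + 1) div 2 \<and> 1 \<le> a \<and> a \<le> n - d - 2
              \<and> graph_iso n E n (G_ndra n d r a))"
      using graph_iso_trans[OF iso] by blast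
  next
    assume "(\<exists>t. 2 \<le> t \<and> t \<le> d div 2 + 1 \<and> graph_iso n E n (G_ndt n d t))
       \<or> (\<exists>r a. 2 \<le> r \<and> r \<le> (d + 1) div 2 \<and> 1 \<le> a \<and> a \<le> n - d - 2
              \<and> graph_iso n E n (G_ndra n d r a))"
    then have "n - d \<le> lap_count n E ?I"
    proof (elim disjE exE conjE)
      fix t assume t: "2 \<le> t" "t \<le> d div 2 + 1" "graph_iso n E n (G_ndt n d t)"
      then show ?thesis
        using lap_count_G_ndt[of t d n] lap_count_graph_iso[OF t(3)] F.dn assms(5) by simp
    next
      \<comment> \<open>The two bounds on \<open>r\<close> force \<open>d\<close> to be at least 3,
        and then \<open>r + 1 \<le> d\<close>, as the lower bound for \<open>G_ndra\<close>
        requires.\<close>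
      fix r a assume r: "2 \<le> r" "r \<le> (d + 1) div 2" "graph_iso n E n (G_ndra n d r a)"
      then show ?thesis
        using lap_count_G_ndra[of r d n a] lap_count_graph_iso[OF r(3)] F.dn by simp
    qed
    then show "lap_count n E ?I = n - d" using le by simp
  qed (rule le)
qed

end
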